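(* Let $G_n$ be the $n\times n$ grid graph with vertices $(x,y)$, $1\le x,y\le n$, adjacent iff they differ by $1$ in exactly one coordinate. Let $\mathbb{P}_n$ be the distribution under which $E=(x_E,y_E)$ and $F=(x_F,y_F)$ are two independent uniformly random vertices of $G_n$, and let $G_n'$ be $G_n$ with the edge $e_n=EF$ added. Let ${\rm Gain}'=\max\big(0,\,\big||y_F-y_E|-|x_E-x_F|\big|-1\big)$ and let $\mathcal{C}_n$ be the event "${\rm Gain}'$ is odd or $\min(|x_E-x_F|,|y_E-y_F|)<\frac{{\rm Gain}'}{2}+2$". Then $$\lim_{n\to\infty}\mathbb{P}_n\big(\beta(G_n')\in\{3,4\}\big)=1,\qquad \lim_{n\to\infty}\mathbb{P}_n\big(\beta(G_n')=3 \,\big|\, \mathcal{C}_n\big)=1,\qquad \lim_{n\to\infty}\mathbb{P}_n(\mathcal{C}_n)=\frac{19}{27}.$$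
   Context: For a connected graph $H$, a set $R$ of vertices is resolving if every pair of distinct vertices $A\ne B$ has some $X\in R$ with $d_H(A,X)\ne d_H(B,X)$, where $d_H$ is shortest-path distance; the metric dimension $\beta(H)$ is the minimum size of a resolving set. When $E$ and $F$ coincide or are adjacent (an event of vanishing probability), $G_n'$ is understood to be $G_n$. *)

theory Defs
  imports "HOL-Probability.Probability"
begin

text \<open>
  A graph is given by a finite vertex set \<open>V\<close> and a symmetric irreflexive adjacency relation
  \<open>E \<subseteq> V \<times> V\<close>.
\<close>

definition path_between :: "'a rel \<Rightarrow> 'a \<Rightarrow> 'a list \<Rightarrow> 'a \<Rightarrow> bool" where
  "path_between E a p b \<longleftrightarrow>
     p \<noteq> [] \<and> hd p = a \<and> last p = b \<and> distinct p \<and> successively (\<lambda>u v. (u, v) \<in> E) p"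

text \<open>The length of a path is its number of edges. If \<open>b\<close> is not reachable from \<open>a\<close>, the value
  is meaningless; only connected graphs are of interest.\<close>

definition graph_dist :: "'a rel \<Rightarrow> 'a \<Rightarrow> 'a \<Rightarrow> nat" where
  "graph_dist E a b = (LEAST k. \<exists>p. path_between E a p b \<and> length p = k + 1)"

definition resolving_set :: "'a set \<Rightarrow> 'a rel \<Rightarrow> 'a set \<Rightarrow> bool" where
  "resolving_set V E R \<longleftrightarrow> R \<subseteq> V \<and>
     (\<forall>a\<in>V. \<forall>b\<in>V. a \<noteq> b \<longrightarrow> (\<exists>x\<in>R. graph_dist E a x \<noteq> graph_dist E b x))"

definition metric_dim :: "'a set \<Rightarrow> 'a rel \<Rightarrow> nat" where
  "metric_dim V E = (LEAST k. \<exists>R. finite R \<and> card R = k \<and> resolving_set V E R)"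

lemma graph_dist_eq_relpow: "graph_dist E a b = (LEAST k. (a, b) \<in> E ^^ k)"
proof -
  define P where "P k \<longleftrightarrow> (\<exists>p. path_between E a p b \<and> length p = k + 1)" for k
  define Q where "Q k \<longleftrightarrow> (a, b) \<in> E ^^ k" for k
  have PQ: "Q k" if "P k" for k
  proof -
    from that obtain p where p: "path_between E a p b" "length p = k + 1"
      by (auto simp: P_def)
    then have "p ! 0 = a" "p ! k = b"
      by (auto simp: path_between_def hd_conv_nth last_conv_nth)
    moreover have "\<forall>i<k. (p ! i, p ! Suc i) \<in> E"
      using p by (auto simp: path_between_def successively_conv_nth)
    ultimately show ?thesis
      unfolding Q_def relpow_fun_conv by (intro exI[of _ "nth p"]) auto
  qed
  have least: "P (LEAST k. Q k)" if ex: "\<exists>k. Q k"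
  proof -
    define m where "m = (LEAST k. Q k)"
    have Qm: "Q m" using ex unfolding m_def by (auto intro: LeastI)
    then obtain f where f: "f 0 = a" "f m = b" "\<And>i. i < m \<Longrightarrow> (f i, f (Suc i)) \<in> E"
      unfolding Q_def relpow_fun_conv by auto
    have seg: "(f i, f j) \<in> E ^^ (j - i)" if "i \<le> j" "j \<le> m" for i j
      unfolding relpow_fun_conv using that f(3) by (intro exI[of _ "\<lambda>l. f (i + l)"]) auto
    have ne: "f i \<noteq> f j" if ij: "i < j" "j \<le> m" for i j
    proof
      assume "f i = f j"
      then have "(f 0, f m) \<in> E ^^ i O E ^^ (m - j)"
        using seg[of 0 i] seg[of j m] ij by (intro relcompI[of _ "f i"]) auto
      then have "(f 0, f m) \<in> E ^^ (i + (m - j))"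
        by (simp only: relpow_add)
      then have "Q (i + (m - j))" using f by (simp add: Q_def)
      then have "m \<le> i + (m - j)" unfolding m_def by (rule Least_le)
      then show False using ij by linarith
    qed
    have "inj_on f {0..<Suc m}"
      by (rule inj_onI) (metis ne atLeastLessThan_iff less_Suc_eq_le linorder_neqE_nat)
    then have "path_between E a (map f [0..<Suc m]) b"
      using f by (auto simp: path_between_def distinct_map successively_conv_nth hd_map
          simp del: upt_Suc simp: last_map)
    then show ?thesis unfolding P_def m_def[symmetric] by (intro exI) auto
  qed
  have "(LEAST k. P k) = (LEAST k. Q k)"
  proof (cases "\<exists>k. Q k")
    case True
    then show ?thesis
      by (intro Least_equality least) (auto intro: Least_le PQ)
  next
    case False
    then have "P = Q" using PQ by (intro ext) auto
    then show ?thesis by simp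
  qed
  then show ?thesis by (simp add: graph_dist_def P_def Q_def)
qed

definition grid_verts :: "nat \<Rightarrow> (int \<times> int) set" where
  "grid_verts n = {1..int n} \<times> {1..int n}"

definition grid_adj :: "nat \<Rightarrow> (int \<times> int) rel" where
  "grid_adj n = {((x, y), (x', y')).
     (x, y) \<in> grid_verts n \<and> (x', y') \<in> grid_verts n \<and>
     ((\<bar>x - x'\<bar> = 1 \<and> y = y') \<or> (x = x' \<and> \<bar>y - y'\<bar> = 1))}"

definition grid_plus_adj :: "nat \<Rightarrow> int \<times> int \<Rightarrow> int \<times> int \<Rightarrow> (int \<times> int) rel" where
  "grid_plus_adj n e f =
     (if e = f \<or> (e, f) \<in> grid_adj n then grid_adj n else grid_adj n \<union> {(e, f), (f, e)})"

definition endpoints_pmf :: "nat \<Rightarrow> ((int \<times> int) \<times> (int \<times> int)) pmf" where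
  "endpoints_pmf n = pair_pmf (pmf_of_set (grid_verts n)) (pmf_of_set (grid_verts n))"

definition metric_dim_plus :: "nat \<Rightarrow> (int \<times> int) \<times> (int \<times> int) \<Rightarrow> nat" where
  "metric_dim_plus n = (\<lambda>(e, f). metric_dim (grid_verts n) (grid_plus_adj n e f))"

definition gain' :: "(int \<times> int) \<times> (int \<times> int) \<Rightarrow> int" where
  "gain' = (\<lambda>((xE, yE), (xF, yF)). max 0 (\<bar>\<bar>yF - yE\<bar> - \<bar>xE - xF\<bar>\<bar> - 1))"

definition event_C :: "(int \<times> int) \<times> (int \<times> int) \<Rightarrow> bool" where
  "event_C = (\<lambda>((xE, yE), (xF, yF)).
     odd (gain' ((xE, yE), (xF, yF))) \<or>
     real_of_int (min \<bar>xE - xF\<bar> \<bar>yE - yF\<bar>) < real_of_int (gain' ((xE, yE), (xF, yF))) / 2 + 2)"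

end

theory Submission imports Defs begin

text \<open>
  Write \<open>dx\<close>, \<open>dy\<close> for the coordinate differences of the edge \<open>EF\<close>. All bounds hold when the endpoints avoid
  a set of lower-dimensional coincidences, which has vanishing probability.

  Lower bound. If the edge shortens the distance from \<open>F\<close> to a landmark \<open>X\<close> by at least 2, then the four grid
  neighbours of \<open>F\<close> are equidistant from \<open>X\<close>, and any second landmark takes only three values on them. If no
  landmark has this property at \<open>E\<close> or \<open>F\<close>, then both landmarks are almost equidistant from \<open>E\<close> and \<open>F\<close>; the
  same argument at \<open>X\<close> puts \<open>X\<close> on the boundary away from the corners, and then two of its three neighbours
  have the same distance to the second landmark for parity reasons.

  Upper bounds. By symmetry \<open>E\<close> is below and to the left of \<open>F\<close> and \<open>dx < dy\<close>. A boundary vertex whose distances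
  to \<open>E\<close> and \<open>F\<close> differ by at most 1 does not see the edge; there is such a vertex \<open>(1, z)\<close> on the left side and
  \<open>(n, w)\<close> on the right side, with \<open>z - w = dx\<close>. If \<open>dx + dy\<close> is even, \<open>(1, 1)\<close>, \<open>(1, z)\<close>, \<open>(n, z)\<close> resolve.
  Otherwise \<open>(1, z)\<close> and \<open>(n, w)\<close> leave unresolved only pairs on a diagonal of the strip between the heights \<open>w\<close>
  and \<open>z\<close> and pairs related by a glide reflection. Adding two opposite corners resolves these, and so does the
  single vertex \<open>(1, w)\<close> provided that it does not see the edge inside the strip, i.e. if \<open>3 dx \<le> dy + 1\<close>.

  Up to coincidences the event \<open>C\<close> says that \<open>dx + dy\<close> is even or \<open>3 min dx dy < max dx dy\<close>. The second condition
  has limiting probability 11/27 and is asymptotically independent of the parity.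
\<close>

subsection \<open>Distances in the grid with an extra edge\<close>

definition grid_dist :: "int \<times> int \<Rightarrow> int \<times> int \<Rightarrow> int" where
  "grid_dist a b = \<bar>fst a - fst b\<bar> + \<bar>snd a - snd b\<bar>"

text \<open>A shortest path avoids the new edge or crosses it once, in one of its two directions.
  When \<open>e\<close> and \<open>f\<close> coincide or are adjacent, the minimum is just
  \<open>grid_dist\<close>. Integer values avoid truncated subtraction.\<close>

definition plus_dist :: "int \<times> int \<Rightarrow> int \<times> int \<Rightarrow> int \<times> int \<Rightarrow> int \<times> int \<Rightarrow> int" where
  "plus_dist e f a x = min (grid_dist a x) (min (grid_dist a e + 1 + grid_dist f x) (grid_dist a f + 1 + grid_dist e x))"

lemma grid_dist_nonneg: "0 \<le> grid_dist a b"
  by (simp add: grid_dist_def)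

lemma grid_dist_commute: "grid_dist a b = grid_dist b a"
  by (simp add: grid_dist_def abs_minus_commute)

lemma grid_dist_self [simp]: "grid_dist a a = 0"
  by (simp add: grid_dist_def)

lemma grid_dist_eq_0_iff: "grid_dist a b = 0 \<longleftrightarrow> a = b"
  by (auto simp: grid_dist_def prod_eq_iff)

lemma grid_dist_triangle: "grid_dist a c \<le> grid_dist a b + grid_dist b c"
  unfolding grid_dist_def by linarith

lemma grid_adj_iff:
  "(a, b) \<in> grid_adj n \<longleftrightarrow> a \<in> grid_verts n \<and> b \<in> grid_verts n \<and> grid_dist a b = 1"
  by (cases a; cases b) (auto simp: grid_adj_def grid_dist_def)

text \<open>Induction on the distance: a step towards \<open>b\<close>, horizontal as long as
  possible and then vertical, stays in the square and lowers the distance by one.\<close>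

lemma grid_relpow:
  assumes "a \<in> grid_verts n" "b \<in> grid_verts n"
  shows "(a, b) \<in> grid_adj n ^^ nat (grid_dist a b)"
  using assms
proof (induction "nat (grid_dist a b)" arbitrary: a)
  case 0
  then show ?case
    using grid_dist_nonneg[of a b] by (auto simp: grid_dist_eq_0_iff)
next
  case (Suc k)
  obtain a1 a2 b1 b2 where ab: "a = (a1, a2)" "b = (b1, b2)" by (metis surj_pair)
  define c where "c = (if a1 < b1 then (a1 + 1, a2) else if b1 < a1 then (a1 - 1, a2)
     else if a2 < b2 then (a1, a2 + 1) else (a1, a2 - 1))"
  have c: "grid_dist a c = 1" "grid_dist c b = grid_dist a b - 1" "c \<in> grid_verts n"
    using Suc ab by (auto simp: c_def grid_dist_def grid_verts_def)
  then have "k = nat (grid_dist c b)" using Suc by auto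
  with Suc c have "(c, b) \<in> grid_adj n ^^ k" by metis
  moreover have "(a, c) \<in> grid_adj n" using c Suc by (auto simp: grid_adj_iff)
  ultimately have "(a, b) \<in> grid_adj n ^^ Suc k" by (meson relpow_Suc_I2)
  then show ?case using Suc by metis
qed

lemma plus_dist_cases:
  obtains "plus_dist e f a x = grid_dist a x" | "plus_dist e f a x = grid_dist a e + 1 + grid_dist f x"
  | "plus_dist e f a x = grid_dist a f + 1 + grid_dist e x"
  unfolding plus_dist_def by linarith

lemma plus_dist_nonneg: "0 \<le> plus_dist e f a x"
  by (simp add: plus_dist_def grid_dist_nonneg)

lemma plus_dist_self [simp]: "plus_dist e f a a = 0"
  using grid_dist_nonneg by (simp add: plus_dist_def grid_dist_nonneg)

lemma plus_dist_swap: "plus_dist e f = plus_dist f e"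
  by (intro ext) (auto simp: plus_dist_def)

text \<open>By the triangle inequality each of the three terms of the minimum is 1-Lipschitz in its
  first argument.\<close>

lemma plus_dist_grid_step: "plus_dist e f a x \<le> plus_dist e f b x + grid_dist a b"
  using grid_dist_triangle[of a x b] grid_dist_triangle[of a e b] grid_dist_triangle[of a f b]
  unfolding plus_dist_def by linarith

lemma plus_dist_edge_step: "plus_dist e f e x \<le> plus_dist e f f x + 1"
  using grid_dist_nonneg[of f e] unfolding plus_dist_def by auto

text \<open>The step is a grid edge, where the Lipschitz bound applies, or the new edge, whose use
  costs 1. Hence no walk is shorter than \<open>plus_dist\<close>.\<close>

lemma grid_plus_adj_step:
  assumes "(a, b) \<in> grid_plus_adj n e f"
  shows "plus_dist e f a x \<le> plus_dist e f b x + 1"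
proof -
  consider "grid_dist a b = 1" | "a = e" "b = f" | "a = f" "b = e"
    using assms by (auto simp: grid_plus_adj_def grid_adj_iff split: if_splits)
  then show ?thesis
    using plus_dist_grid_step[of e f a x b] plus_dist_edge_step[of e f x] plus_dist_edge_step[of f e x]
    by cases (auto simp: plus_dist_swap)
qed

lemma plus_dist_le_relpow: "(a, x) \<in> grid_plus_adj n e f ^^ k \<Longrightarrow> plus_dist e f a x \<le> int k"
proof (induction k arbitrary: a)
  case (Suc k)
  then obtain b where b: "(a, b) \<in> grid_plus_adj n e f" "(b, x) \<in> grid_plus_adj n e f ^^ k"
    by (meson relpow_Suc_D2)
  then show ?case
    using Suc.IH[OF b(2)] grid_plus_adj_step[OF b(1), of x] by simp
qed auto

lemma grid_plus_adj_swap: "grid_plus_adj n e f = grid_plus_adj n f e"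
  by (auto simp: grid_plus_adj_def grid_adj_iff grid_dist_commute)

lemma relpow_mono:
  fixes R S :: "'a rel"
  shows "R \<subseteq> S \<Longrightarrow> R ^^ k \<subseteq> S ^^ k"
  by (induction k) auto

lemma grid_plus_relpow:
  assumes "a \<in> grid_verts n" "b \<in> grid_verts n"
  shows "(a, b) \<in> grid_plus_adj n e f ^^ nat (grid_dist a b)"
proof -
  have "grid_adj n \<subseteq> grid_plus_adj n e f" by (auto simp: grid_plus_adj_def)
  then show ?thesis using grid_relpow[OF assms] relpow_mono by blast
qed

lemma relpow_via_edge:
  assumes "a \<in> grid_verts n" "x \<in> grid_verts n" "e \<in> grid_verts n" "f \<in> grid_verts n"
    and "(e, f) \<in> grid_plus_adj n e f"
  shows "(a, x) \<in> grid_plus_adj n e f ^^ nat (grid_dist a e + 1 + grid_dist f x)"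
proof -
  have "(a, f) \<in> grid_plus_adj n e f ^^ Suc (nat (grid_dist a e))"
    using grid_plus_relpow[OF assms(1,3), of e f] assms(5) by auto
  then have "(a, x) \<in> grid_plus_adj n e f ^^ (Suc (nat (grid_dist a e)) + nat (grid_dist f x))"
    unfolding relpow_add using grid_plus_relpow[OF assms(4,2)] by (rule relcompI)
  also have "Suc (nat (grid_dist a e)) + nat (grid_dist f x) = nat (grid_dist a e + 1 + grid_dist f x)"
    using grid_dist_nonneg[of a e] grid_dist_nonneg[of f x] by linarith
  finally show ?thesis .
qed

lemma relpow_plus_dist:
  assumes "a \<in> grid_verts n" "x \<in> grid_verts n" "e \<in> grid_verts n" "f \<in> grid_verts n"
  shows "(a, x) \<in> grid_plus_adj n e f ^^ nat (plus_dist e f a x)"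
proof (cases "e = f \<or> (e, f) \<in> grid_adj n")
  case True
  \<comment> \<open>With no extra edge present, both detours through \<open>e\<close> and
    \<open>f\<close> are at least as long as the direct route.\<close>
  then have "grid_dist e f \<le> 1" by (auto simp: grid_adj_iff)
  then have "plus_dist e f a x = grid_dist a x"
    using grid_dist_triangle[of a x e] grid_dist_triangle[of a x f] grid_dist_triangle[of e x f]
      grid_dist_triangle[of f x e] grid_dist_commute[of e f] unfolding plus_dist_def by linarith
  then show ?thesis using grid_plus_relpow assms by metis
next
  case False
  then have "(e, f) \<in> grid_plus_adj n e f" "(f, e) \<in> grid_plus_adj n f e"
    by (auto simp: grid_plus_adj_def grid_adj_iff grid_dist_commute)
  then show ?thesis
    using grid_plus_relpow[OF assms(1,2), of e f] relpow_via_edge[of a n x e f] relpow_via_edge[of a n x f e]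
      assms grid_plus_adj_swap
    by (cases rule: plus_dist_cases[of e f a x]) metis+
qed

lemma graph_dist_grid_plus:
  assumes "a \<in> grid_verts n" "x \<in> grid_verts n" "e \<in> grid_verts n" "f \<in> grid_verts n"
  shows "graph_dist (grid_plus_adj n e f) a x = nat (plus_dist e f a x)"
  unfolding graph_dist_eq_relpow
  by (rule Least_equality) (use relpow_plus_dist[OF assms] plus_dist_le_relpow nat_le_iff in blast)+

section \<open>Resolving sets in terms of the distance formula\<close>

definition resolves :: "nat \<Rightarrow> int \<times> int \<Rightarrow> int \<times> int \<Rightarrow> (int \<times> int) set \<Rightarrow> bool" where
  "resolves n e f R \<longleftrightarrow> R \<subseteq> grid_verts n \<and>
     (\<forall>a\<in>grid_verts n. \<forall>b\<in>grid_verts n. (\<forall>x\<in>R. plus_dist e f a x = plus_dist e f b x) \<longrightarrow> a = b)"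

lemma resolving_set_iff_resolves:
  assumes "e \<in> grid_verts n" "f \<in> grid_verts n"
  shows "resolving_set (grid_verts n) (grid_plus_adj n e f) R \<longleftrightarrow> resolves n e f R"
proof -
  have "graph_dist (grid_plus_adj n e f) a x = graph_dist (grid_plus_adj n e f) b x
      \<longleftrightarrow> plus_dist e f a x = plus_dist e f b x"
    if "a \<in> grid_verts n" "b \<in> grid_verts n" "x \<in> grid_verts n" for a b x
    using that assms plus_dist_nonneg[of e f] by (simp add: graph_dist_grid_plus eq_nat_nat_iff)
  then show ?thesis
    unfolding resolving_set_def resolves_def by (meson subset_iff)
qed

lemma finite_grid_verts [simp]: "finite (grid_verts n)"
  by (simp add: grid_verts_def)

lemma metric_dim_plus_le:
  assumes "e \<in> grid_verts n" "f \<in> grid_verts n" "resolves n e f R"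
  shows "metric_dim_plus n (e, f) \<le> card R"
proof -
  have "finite R" using assms(3) finite_grid_verts unfolding resolves_def by (meson finite_subset)
  then show ?thesis
    unfolding metric_dim_plus_def metric_dim_def using assms
    by (auto intro!: Least_le simp: resolving_set_iff_resolves)
qed

lemma metric_dim_plus_ge:
  assumes "e \<in> grid_verts n" "f \<in> grid_verts n"
    and "\<And>R. resolves n e f R \<Longrightarrow> k \<le> card R"
  shows "k \<le> metric_dim_plus n (e, f)"
proof -
  \<comment> \<open>The \<open>LEAST\<close> in the metric dimension is attained only if some
    resolving set exists; the whole vertex set is one, since only \<open>a\<close> has distance 0
    from \<open>a\<close>.\<close>
  have "resolves n e f (grid_verts n)"
    unfolding resolves_def
  proof (intro conjI ballI impI subset_refl)
    fix a b assume "a \<in> grid_verts n" "\<forall>x\<in>grid_verts n. plus_dist e f a x = plus_dist e f b x"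
    then have "plus_dist e f b a = 0" by (metis plus_dist_self)
    then have "grid_dist b a = 0"
      using grid_dist_nonneg[of b a] grid_dist_nonneg[of b e] grid_dist_nonneg[of b f]
        grid_dist_nonneg[of e a] grid_dist_nonneg[of f a] unfolding plus_dist_def by linarith
    then show "a = b" by (simp add: grid_dist_eq_0_iff)
  qed
  then have "\<exists>k R. finite R \<and> card R = k \<and> resolving_set (grid_verts n) (grid_plus_adj n e f) R"
    using assms(1,2) finite_grid_verts resolving_set_iff_resolves by blast
  then have "\<exists>R. finite R \<and> card R = metric_dim_plus n (e, f) \<and>
      resolving_set (grid_verts n) (grid_plus_adj n e f) R"
    unfolding metric_dim_plus_def metric_dim_def case_prod_conv by (rule LeastI_ex)
  then show ?thesis using assms by (metis resolving_set_iff_resolves)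
qed

section \<open>Symmetries of the grid\<close>

locale grid_symmetry =
  fixes n :: nat and \<sigma> :: "int \<times> int \<Rightarrow> int \<times> int"
  assumes invol [simp]: "\<sigma> (\<sigma> a) = a"
    and verts: "a \<in> grid_verts n \<Longrightarrow> \<sigma> a \<in> grid_verts n"
    and grid_dist_eq: "grid_dist (\<sigma> a) (\<sigma> b) = grid_dist a b"
begin

lemma plus_dist_eq: "plus_dist (\<sigma> e) (\<sigma> f) (\<sigma> a) (\<sigma> x) = plus_dist e f a x"
  by (simp add: plus_dist_def grid_dist_eq)

lemma resolves_image:
  assumes "resolves n e f R"
  shows "resolves n (\<sigma> e) (\<sigma> f) (\<sigma> ` R)"
  unfolding resolves_def
proof (intro conjI ballI impI)
  show "\<sigma> ` R \<subseteq> grid_verts n" using assms verts by (auto simp: resolves_def)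
  fix a b assume ab: "a \<in> grid_verts n" "b \<in> grid_verts n"
    and *: "\<forall>x\<in>\<sigma> ` R. plus_dist (\<sigma> e) (\<sigma> f) a x = plus_dist (\<sigma> e) (\<sigma> f) b x"
  have "plus_dist e f (\<sigma> a) x = plus_dist e f (\<sigma> b) x" if "x \<in> R" for x
    using * that plus_dist_eq[of e f "\<sigma> a" x] plus_dist_eq[of e f "\<sigma> b" x] by simp
  then have "\<sigma> a = \<sigma> b"
    using assms ab verts by (auto simp: resolves_def)
  then show "a = b" by (metis invol)
qed

end

text \<open>Together with the transposition and the exchange of \<open>e\<close> and
  \<open>f\<close>, this reflection moves the edge into a normal position and any side of the square
  to the bottom.\<close>

definition reflect_x :: "nat \<Rightarrow> int \<times> int \<Rightarrow> int \<times> int" where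
  "reflect_x n a = (int n + 1 - fst a, snd a)"

interpretation transpose: grid_symmetry n prod.swap
  by unfold_locales (auto simp: grid_verts_def grid_dist_def)

interpretation reflect_x: grid_symmetry n "reflect_x n"
  by unfold_locales (auto simp: grid_verts_def grid_dist_def reflect_x_def)

subsection \<open>Two landmarks do not suffice\<close>

text \<open>The edge costs 1, so a detour from \<open>a\<close> via \<open>e\<close> and
  \<open>f\<close> is at least as long as going to \<open>e\<close> and from there directly to
  \<open>x\<close>.\<close>

lemma plus_dist_no_gain:
  assumes "\<bar>grid_dist e x - grid_dist f x\<bar> \<le> 1"
  shows "plus_dist e f a x = grid_dist a x"
  using grid_dist_triangle[of a x e] grid_dist_triangle[of a x f] assms unfolding plus_dist_def by linarith

text \<open>Entering the edge at \<open>e\<close>, the endpoint nearer to \<open>x\<close>, never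
  pays off, so only the crossing from \<open>f\<close> to \<open>e\<close> remains.\<close>

lemma plus_dist_gain:
  assumes "grid_dist e x \<le> grid_dist f x"
  shows "plus_dist e f a x = min (grid_dist a x) (grid_dist a f + 1 + grid_dist e x)"
  using grid_dist_triangle[of a x e] assms unfolding plus_dist_def by linarith

definition unresolved :: "nat \<Rightarrow> int \<times> int \<Rightarrow> int \<times> int \<Rightarrow> int \<times> int \<Rightarrow> int \<times> int \<Rightarrow> bool" where
  "unresolved n e f x y \<longleftrightarrow> (\<exists>a\<in>grid_verts n. \<exists>b\<in>grid_verts n. a \<noteq> b \<and>
     plus_dist e f a x = plus_dist e f b x \<and> plus_dist e f a y = plus_dist e f b y)"

lemma unresolvedI:
  assumes "a \<in> grid_verts n" "b \<in> grid_verts n" "a \<noteq> b"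
    "plus_dist e f a x = plus_dist e f b x" "plus_dist e f a y = plus_dist e f b y"
  shows "unresolved n e f x y"
  using assms unfolding unresolved_def by blast

lemma unresolved_commute: "unresolved n e f x y \<longleftrightarrow> unresolved n e f y x"
  unfolding unresolved_def by blast

lemma unresolved_swap: "unresolved n e f x y \<longleftrightarrow> unresolved n f e x y"
  unfolding unresolved_def by (simp add: plus_dist_swap)

lemma (in grid_symmetry) unresolved_image:
  assumes "unresolved n (\<sigma> e) (\<sigma> f) (\<sigma> x) (\<sigma> y)"
  shows "unresolved n e f x y"
proof -
  from assms obtain a b where ab: "a \<in> grid_verts n" "b \<in> grid_verts n" "a \<noteq> b"
    "plus_dist (\<sigma> e) (\<sigma> f) a (\<sigma> x) = plus_dist (\<sigma> e) (\<sigma> f) b (\<sigma> x)"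
    "plus_dist (\<sigma> e) (\<sigma> f) a (\<sigma> y) = plus_dist (\<sigma> e) (\<sigma> f) b (\<sigma> y)"
    unfolding unresolved_def by blast
  then have "\<sigma> a \<noteq> \<sigma> b" by (metis invol)
  then show ?thesis
    using ab verts plus_dist_eq[of e f "\<sigma> a"] plus_dist_eq[of e f "\<sigma> b"]
    by (intro unresolvedI[of "\<sigma> a" _ "\<sigma> b"]) auto
qed

text \<open>The distances of the four neighbours to \<open>y\<close> differ by at most 1 from that of \<open>p\<close>,
  so two of them agree.\<close>

lemma unresolved_if_neighbours_equidistant:
  assumes p: "fst p \<in> {2..int n - 1}" "snd p \<in> {2..int n - 1}"
    and eq: "\<And>q. grid_dist q p = 1 \<Longrightarrow> plus_dist e f q x = c"
  shows "unresolved n e f x y"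
proof -
  define q1 q2 q3 q4 where q: "q1 = (fst p + 1, snd p)" "q2 = (fst p - 1, snd p)"
    "q3 = (fst p, snd p + 1)" "q4 = (fst p, snd p - 1)"
  have V: "q1 \<in> grid_verts n" "q2 \<in> grid_verts n" "q3 \<in> grid_verts n" "q4 \<in> grid_verts n"
    using p by (auto simp: q grid_verts_def)
  have adj: "grid_dist q1 p = 1" "grid_dist q2 p = 1" "grid_dist q3 p = 1" "grid_dist q4 p = 1"
    by (auto simp: q grid_dist_def)
  have near: "\<bar>plus_dist e f q y - plus_dist e f p y\<bar> \<le> 1" if "grid_dist q p = 1" for q
    using that plus_dist_grid_step[of e f q y p] plus_dist_grid_step[of e f p y q] grid_dist_commute[of p q] by linarith
  have ne: "q1 \<noteq> q2" "q1 \<noteq> q3" "q1 \<noteq> q4" "q2 \<noteq> q3" "q2 \<noteq> q4" "q3 \<noteq> q4"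
    by (auto simp: q)
  consider "plus_dist e f q1 y = plus_dist e f q2 y" | "plus_dist e f q1 y = plus_dist e f q3 y"
    | "plus_dist e f q1 y = plus_dist e f q4 y" | "plus_dist e f q2 y = plus_dist e f q3 y"
    | "plus_dist e f q2 y = plus_dist e f q4 y" | "plus_dist e f q3 y = plus_dist e f q4 y"
    using adj[THEN near] by linarith
  then show ?thesis
    using V ne adj[THEN eq] by cases (metis unresolvedI)+
qed

text \<open>The range \<open>{3..int n - 2}\<close> makes the neighbours of an endpoint vertices and
  keeps the endpoints above the two lowest rows. The bound 7 keeps boundary vertices almost
  equidistant from \<open>e\<close> and \<open>f\<close> away from the corners and from the row or
  column of an endpoint.\<close>

definition generic :: "nat \<Rightarrow> int \<times> int \<Rightarrow> int \<times> int \<Rightarrow> bool" where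
  "generic n e f \<longleftrightarrow> {fst e, snd e, fst f, snd f} \<subseteq> {3..int n - 2} \<and>
     fst e \<noteq> fst f \<and> snd e \<noteq> snd f \<and>
     7 \<le> \<bar>\<bar>fst e - fst f\<bar> - \<bar>snd e - snd f\<bar>\<bar>"

lemma generic_swap: "generic n e f \<longleftrightarrow> generic n f e"
  unfolding generic_def by (auto simp: abs_minus_commute)

lemma generic_transpose: "generic n (prod.swap e) (prod.swap f) \<longleftrightarrow> generic n e f"
  unfolding generic_def by auto

lemma generic_reflect_x: "generic n (reflect_x n e) (reflect_x n f) \<longleftrightarrow> generic n e f"
  unfolding generic_def by (auto simp: reflect_x_def abs_minus_commute)

text \<open>Every neighbour of \<open>f\<close> has grid distance at least
  \<open>grid_dist e x + 2\<close> from \<open>x\<close>, and this is what the route through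
  \<open>f\<close> and \<open>e\<close> costs; so all four neighbours of \<open>f\<close> are
  equidistant from \<open>x\<close>.\<close>

lemma unresolved_if_large_gain:
  assumes "generic n e f" "grid_dist e x + 3 \<le> grid_dist f x"
  shows "unresolved n e f x y"
proof (rule unresolved_if_neighbours_equidistant)
  show "fst f \<in> {2..int n - 1}" "snd f \<in> {2..int n - 1}"
    using assms by (auto simp: generic_def)
  show "plus_dist e f q x = 2 + grid_dist e x" if "grid_dist q f = 1" for q
    using assms that grid_dist_triangle[of f x q] grid_dist_commute[of f q] by (simp add: plus_dist_gain)
qed

text \<open>The four neighbours of \<open>x\<close> are all at distance 1 from
  \<open>x\<close>.\<close>

lemma unresolved_if_interior:
  assumes "fst x \<in> {2..int n - 1}" "snd x \<in> {2..int n - 1}"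
  shows "unresolved n e f x y"
proof (rule unresolved_if_neighbours_equidistant[OF assms])
  show "plus_dist e f q x = 1" if "grid_dist q x = 1" for q
    using that grid_dist_nonneg[of q e] grid_dist_nonneg[of q f] grid_dist_nonneg[of f x] grid_dist_nonneg[of e x]
    by (simp add: plus_dist_def)
qed

text \<open>The three neighbours of \<open>x\<close> are at distance 1 from \<open>x\<close>, and
  two of them agree on \<open>y\<close>: this holds in the plain grid, and the edge shortens all
  three distances to \<open>y\<close> by the same amount, 0 or 1.\<close>

lemma unresolved_bottom_aux:
  assumes gen: "generic n e f" and x: "x \<in> grid_verts n" "snd x = 1"
    and small: "\<bar>grid_dist e x - grid_dist f x\<bar> \<le> 2" "\<bar>grid_dist e y - grid_dist f y\<bar> \<le> 2" "grid_dist e y \<le> grid_dist f y"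
  shows "unresolved n e f x y"
proof -
  define q1 q2 q3 where q: "q1 = (fst x - 1, snd x)" "q2 = (fst x + 1, snd x)"
    "q3 = (fst x, snd x + 1)"
  \<comment> \<open>At a bottom corner the distances to \<open>e\<close> and \<open>f\<close> would
    differ by at least 7.\<close>
  have x1: "1 < fst x" "fst x < int n"
    using gen x small(1) unfolding generic_def grid_dist_def grid_verts_def by auto
  then have V: "q1 \<in> grid_verts n" "q2 \<in> grid_verts n" "q3 \<in> grid_verts n"
    using gen x by (auto simp: q grid_verts_def generic_def)
  have adj: "grid_dist q1 x = 1" "grid_dist q2 x = 1" "grid_dist q3 x = 1"
    by (auto simp: q grid_dist_def)
  have dx: "plus_dist e f q x = 1" if "grid_dist q x = 1" for q
    using that grid_dist_nonneg[of q e] grid_dist_nonneg[of q f] grid_dist_nonneg[of f x] grid_dist_nonneg[of e x]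
    by (simp add: plus_dist_def)
  \<comment> \<open>Were \<open>fst x\<close> within 2 of \<open>fst f\<close>, then
    \<open>\<bar>fst e - fst f\<bar>\<close> and \<open>\<bar>snd e - snd f\<bar>\<close> would
    differ by at most 6.\<close>
  have far: "3 \<le> \<bar>fst x - fst f\<bar>"
    using gen x small(1) unfolding generic_def grid_dist_def by auto
  have ne: "q1 \<noteq> q2" "q1 \<noteq> q3" "q2 \<noteq> q3" by (auto simp: q)
  \<comment> \<open>The grid is bipartite: a neighbour's distance to \<open>y\<close> is one more or
    one less than that of \<open>x\<close>, which leaves two values for three vertices.\<close>
  have parity: "grid_dist q1 y = grid_dist q2 y \<or> grid_dist q1 y = grid_dist q3 y \<or> grid_dist q2 y = grid_dist q3 y"
    unfolding grid_dist_def q by (cases "fst x" "fst y" rule: linorder_cases; cases "snd x < snd y") auto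
  \<comment> \<open>If \<open>f\<close> is exactly 2 farther from \<open>y\<close> than
    \<open>e\<close>, the edge saves 1 when \<open>f\<close> lies on a grid geodesic from
    \<open>q\<close> to \<open>y\<close>, and nothing otherwise. All three \<open>q\<close> lie on
    the same side of \<open>f\<close>, so they agree in this.\<close>
  have "(\<forall>q\<in>{q1, q2, q3}. plus_dist e f q y = grid_dist q y) \<or> (\<forall>q\<in>{q1, q2, q3}. plus_dist e f q y = grid_dist q y - 1)"
  proof (cases "grid_dist f y = grid_dist e y + 2")
    case True
    have d: "plus_dist e f q y = min (grid_dist q y) (grid_dist q f + grid_dist f y - 1)" for q
      using True by (simp add: plus_dist_gain)
    have side: "\<forall>q\<in>{q1, q2, q3}. snd q < snd f"
      "(\<forall>q\<in>{q1, q2, q3}. fst q < fst f) \<or> (\<forall>q\<in>{q1, q2, q3}. fst f < fst q)"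
      using far gen x by (auto simp: q generic_def)
    have between: "plus_dist e f q y = grid_dist q y - 1"
      if "snd q < snd f" "snd f \<le> snd y" "fst q < fst f \<and> fst f \<le> fst y \<or> fst f < fst q \<and> fst y \<le> fst f" for q
      using that unfolding d grid_dist_def by auto
    have not_between: "plus_dist e f q y = grid_dist q y"
      if "snd q < snd f" "snd y < snd f \<or> fst q < fst f \<and> fst y < fst f \<or> fst f < fst q \<and> fst f < fst y" for q
      using that unfolding d grid_dist_def by auto
    show ?thesis
      using side between not_between by (meson not_le)
  next
    case False
    then have "plus_dist e f q y = grid_dist q y" for q
      using small by (intro plus_dist_no_gain) auto
    then show ?thesis by blast
  qed
  then consider "plus_dist e f q1 y = plus_dist e f q2 y" | "plus_dist e f q1 y = plus_dist e f q3 y"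
    | "plus_dist e f q2 y = plus_dist e f q3 y"
    using parity by auto
  then show ?thesis
    using V ne adj[THEN dx] by cases (metis unresolvedI)+
qed

lemma unresolved_bottom:
  assumes gen: "generic n e f" and x: "x \<in> grid_verts n" "snd x = 1"
    and small: "\<bar>grid_dist e x - grid_dist f x\<bar> \<le> 2" "\<bar>grid_dist e y - grid_dist f y\<bar> \<le> 2"
  shows "unresolved n e f x y"
proof (cases "grid_dist e y \<le> grid_dist f y")
  case True
  then show ?thesis using unresolved_bottom_aux assms by blast
next
  case False
  then have "unresolved n f e x y"
    using assms by (intro unresolved_bottom_aux) (auto simp: generic_swap)
  then show ?thesis by (simp add: unresolved_swap)
qed

text \<open>Transposition takes the left side to the bottom, reflection the right side to the left,
  and transposition the top to the right.\<close>

lemma unresolved_boundary: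
  assumes gen: "generic n e f" and x: "x \<in> grid_verts n"
    and bd: "fst x = 1 \<or> fst x = int n \<or> snd x = 1 \<or> snd x = int n"
    and small: "\<bar>grid_dist e x - grid_dist f x\<bar> \<le> 2" "\<bar>grid_dist e y - grid_dist f y\<bar> \<le> 2"
  shows "unresolved n e f x y"
proof -
  have left: "unresolved n e f x y"
    if "generic n e f" "x \<in> grid_verts n" "fst x = 1"
      "\<bar>grid_dist e x - grid_dist f x\<bar> \<le> 2" "\<bar>grid_dist e y - grid_dist f y\<bar> \<le> 2" for e f x y
    by (rule transpose.unresolved_image, rule unresolved_bottom)
      (use that in \<open>auto simp: generic_transpose transpose.verts transpose.grid_dist_eq\<close>)
  have right: "unresolved n e f x y"
    if "generic n e f" "x \<in> grid_verts n" "fst x = int n"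
      "\<bar>grid_dist e x - grid_dist f x\<bar> \<le> 2" "\<bar>grid_dist e y - grid_dist f y\<bar> \<le> 2" for e f x y
    by (rule reflect_x.unresolved_image, rule left)
      (use that in \<open>auto simp: generic_reflect_x reflect_x.verts reflect_x.grid_dist_eq\<close>, auto simp: reflect_x_def)
  have "unresolved n e f x y" if "snd x = int n"
    by (rule transpose.unresolved_image, rule right)
      (use that assms in \<open>auto simp: generic_transpose transpose.verts transpose.grid_dist_eq\<close>)
  then show ?thesis using bd left right unresolved_bottom assms by blast
qed

lemma unresolved_pair:
  assumes gen: "generic n e f" and "x \<in> grid_verts n" "y \<in> grid_verts n"
  shows "unresolved n e f x y"
proof -
  have large: "unresolved n e f x y" if "3 \<le> \<bar>grid_dist e x - grid_dist f x\<bar>" for x y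
  proof (cases "grid_dist e x \<le> grid_dist f x")
    case True
    then show ?thesis using unresolved_if_large_gain[OF gen] that by auto
  next
    case False
    then have "unresolved n f e x y"
      using unresolved_if_large_gain[of n f e] gen generic_swap that by auto
    then show ?thesis by (simp add: unresolved_swap)
  qed
  consider "3 \<le> \<bar>grid_dist e x - grid_dist f x\<bar>" | "3 \<le> \<bar>grid_dist e y - grid_dist f y\<bar>"
    | "\<bar>grid_dist e x - grid_dist f x\<bar> \<le> 2" "\<bar>grid_dist e y - grid_dist f y\<bar> \<le> 2" by linarith
  then show ?thesis
  proof cases
    case 3
    show ?thesis
    proof (cases "fst x = 1 \<or> fst x = int n \<or> snd x = 1 \<or> snd x = int n")
      case True
      then show ?thesis using unresolved_boundary[OF gen assms(2) True 3] by simp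
    next
      case False
      then show ?thesis using assms by (intro unresolved_if_interior) (auto simp: grid_verts_def)
    qed
  qed (use large unresolved_commute in blast)+
qed

lemma three_le_card_if_resolves:
  assumes gen: "generic n e f" and R: "resolves n e f R"
  shows "3 \<le> card R"
proof (rule ccontr)
  have fin: "finite R" using R finite_grid_verts unfolding resolves_def by (meson finite_subset)
  \<comment> \<open>A vertex to choose for \<open>x\<close> and \<open>y\<close> in case
    \<open>R\<close> is empty.\<close>
  have V: "(3, 3) \<in> grid_verts n" using gen by (auto simp: generic_def grid_verts_def)
  assume "\<not> 3 \<le> card R"
  then have "card R = 0 \<or> card R = 1 \<or> card R = 2" by linarith
  then obtain x y where xy: "R \<subseteq> {x, y}" "x \<in> grid_verts n" "y \<in> grid_verts n"
    using V R fin unfolding resolves_def card_2_iff card_1_singleton_iff One_nat_def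
    by (elim disjE) fastforce+
  from unresolved_pair[OF gen xy(2,3)] show False
    using R xy(1) unfolding unresolved_def resolves_def by blast
qed

subsection \<open>Small resolving sets\<close>

text \<open>The two vertices play symmetric roles, so the lower one may be named first; this halves
  the case distinctions below.\<close>

lemma resolvesI:
  assumes "R \<subseteq> grid_verts n"
    and *: "\<And>a1 a2 b1 b2. a2 \<le> b2 \<Longrightarrow> (a1, a2) \<in> grid_verts n \<Longrightarrow> (b1, b2) \<in> grid_verts n \<Longrightarrow>
      \<forall>x\<in>R. plus_dist e f (a1, a2) x = plus_dist e f (b1, b2) x \<Longrightarrow> a1 = b1 \<and> a2 = b2"
  shows "resolves n e f R"
  unfolding resolves_def
proof (intro conjI ballI impI assms(1))
  fix a b assume ab: "a \<in> grid_verts n" "b \<in> grid_verts n"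
    "\<forall>x\<in>R. plus_dist e f a x = plus_dist e f b x"
  show "a = b"
  proof (cases "snd a \<le> snd b")
    case True
    then show ?thesis using *[of "snd a" "snd b" "fst a" "fst b"] ab by (simp add: prod_eq_iff)
  next
    case False
    then show ?thesis using *[of "snd b" "snd a" "fst b" "fst a"] ab by (simp add: prod_eq_iff)
  qed
qed

text \<open>Since \<open>f1 - e1 + f2 - e2\<close> is even, using the extra edge changes the parity of a distance; as the edge is
  useless for \<open>(1, z)\<close>, unresolved vertices use the edge for the same landmarks.\<close>

lemma three_landmarks_odd_gain:
  assumes e: "(e1, e2) \<in> grid_verts n" and f: "(f1, f2) \<in> grid_verts n"
    and le: "e1 \<le> f1" "f1 - e1 < f2 - e2" and z: "2 * z = e2 + f2 + f1 - e1"
  shows "resolves n (e1, e2) (f1, f2) {(1, 1), (1, z), (int n, z)}"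
proof (rule resolvesI)
  show "{(1, 1), (1, z), (int n, z)} \<subseteq> grid_verts n"
    using assms by (auto simp: grid_verts_def)
next
  \<comment> \<open>\<open>m1\<close> and \<open>m3\<close> are the direct distances to
    \<open>(1, 1)\<close> and \<open>(n, z)\<close>; \<open>d1\<close> and \<open>d3\<close> are the
    lengths of the routes through the edge, crossed from \<open>f\<close> to \<open>e\<close> and
    from \<open>e\<close> to \<open>f\<close> respectively.\<close>
  define d1 d3 m1 m3 where d1: "d1 a1 a2 = \<bar>a1 - f1\<bar> + \<bar>a2 - f2\<bar> + e1 + e2 - 1"
    and d3: "d3 a1 a2 = \<bar>a1 - e1\<bar> + \<bar>a2 - e2\<bar> + 1 + int n - f1 + f2 - z"
    and m1: "m1 a1 a2 = a1 + a2 - 2" and m3: "m3 a1 a2 = int n - a1 + \<bar>a2 - z\<bar>" for a1 a2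
  have D: "plus_dist (e1, e2) (f1, f2) (a1, a2) (1, 1) = min (m1 a1 a2) (d1 a1 a2)"
    "plus_dist (e1, e2) (f1, f2) (a1, a2) (1, z) = a1 - 1 + \<bar>a2 - z\<bar>"
    "plus_dist (e1, e2) (f1, f2) (a1, a2) (int n, z) = min (m3 a1 a2) (d3 a1 a2)"
    if "(a1, a2) \<in> grid_verts n" for a1 a2
  proof -
    show "plus_dist (e1, e2) (f1, f2) (a1, a2) (1, 1) = min (m1 a1 a2) (d1 a1 a2)"
      using assms that
      by (subst plus_dist_gain) (auto simp: m1 d1 grid_dist_def grid_verts_def)
    show "plus_dist (e1, e2) (f1, f2) (a1, a2) (1, z) = a1 - 1 + \<bar>a2 - z\<bar>"
      using assms that
      by (subst plus_dist_no_gain) (auto simp: grid_dist_def grid_verts_def)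
    show "plus_dist (e1, e2) (f1, f2) (a1, a2) (int n, z) = min (m3 a1 a2) (d3 a1 a2)"
      using assms that
      by (subst plus_dist_swap, subst plus_dist_gain) (auto simp: m3 d3 grid_dist_def grid_verts_def)
  qed
  have ev: "even (e1 + e2) \<longleftrightarrow> even (f1 + f2)"
    using z by presburger
  have p1: "odd (m1 a1 a2 + d1 a1 a2)" for a1 a2
    using ev by (auto simp: m1 d1)
  have p3: "odd (m3 a1 a2 + d3 a1 a2)" for a1 a2
  proof -
    have "even (m3 a1 a2 + d3 a1 a2) \<longleftrightarrow> odd (e1 + e2 + f1 + f2)"
      by (auto simp: m3 d3)
    then show ?thesis using ev by auto
  qed
  fix a1 a2 b1 b2
  assume a: "(a1, a2) \<in> grid_verts n" and b: "(b1, b2) \<in> grid_verts n"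
    and eq: "\<forall>x\<in>{(1, 1), (1, z), (int n, z)}. plus_dist (e1, e2) (f1, f2) (a1, a2) x = plus_dist (e1, e2) (f1, f2) (b1, b2) x"
  have eq1: "min (m1 a1 a2) (d1 a1 a2) = min (m1 b1 b2) (d1 b1 b2)"
    and eq2: "a1 + \<bar>a2 - z\<bar> = b1 + \<bar>b2 - z\<bar>"
    and eq3: "min (m3 a1 a2) (d3 a1 a2) = min (m3 b1 b2) (d3 b1 b2)"
    using eq D[OF a] D[OF b] by auto
  have "even (a1 + \<bar>a2 - z\<bar>) = even (b1 + \<bar>b2 - z\<bar>)" using eq2 by simp
  then have par: "even (a1 + a2) \<longleftrightarrow> even (b1 + b2)" by auto
  then have parm: "even (m1 a1 a2) \<longleftrightarrow> even (m1 b1 b2)" "even (m3 a1 a2) \<longleftrightarrow> even (m3 b1 b2)"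
    by (auto simp: m1 m3)
  have pd: "even (d1 a1 a2) \<longleftrightarrow> odd (m1 a1 a2)" "even (d3 a1 a2) \<longleftrightarrow> odd (m3 a1 a2)" for a1 a2
    using p1[of a1 a2] p3[of a1 a2] by auto
  \<comment> \<open>Direct route and detour have opposite parities, and equal distances to
    \<open>(1, z)\<close> give \<open>a\<close> and \<open>b\<close> the same parity; so equal
    minima come from the same kind of route.\<close>
  have c1: "m1 a1 a2 < d1 a1 a2 \<and> m1 b1 b2 < d1 b1 b2 \<and> m1 a1 a2 = m1 b1 b2 \<or>
      d1 a1 a2 < m1 a1 a2 \<and> d1 b1 b2 < m1 b1 b2 \<and> d1 a1 a2 = d1 b1 b2"
    using eq1 parm pd[of a1 a2] pd[of b1 b2]
    by (smt (verit, best) min_def)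
  have c3: "m3 a1 a2 < d3 a1 a2 \<and> m3 b1 b2 < d3 b1 b2 \<and> m3 a1 a2 = m3 b1 b2 \<or>
      d3 a1 a2 < m3 a1 a2 \<and> d3 b1 b2 < m3 b1 b2 \<and> d3 a1 a2 = d3 b1 b2"
    using eq3 parm pd[of a1 a2] pd[of b1 b2]
    by (smt (verit, best) min_def)
  have zb: "e2 < z" "z < f2" using le z by auto
  from c1 c3 consider
      "m1 a1 a2 = m1 b1 b2" "m3 a1 a2 = m3 b1 b2"
    | "d1 a1 a2 = d1 b1 b2" "m3 a1 a2 = m3 b1 b2"
    | "m1 a1 a2 = m1 b1 b2" "d3 a1 a2 = d3 b1 b2" "d3 a1 a2 < m3 a1 a2" "d3 b1 b2 < m3 b1 b2"
    | "d1 a1 a2 < m1 a1 a2" "d3 a1 a2 < m3 a1 a2"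
    by auto
  then show "a1 = b1 \<and> a2 = b2"
  proof cases
    case 1
    then show ?thesis using eq2 unfolding m1 m3 by linarith
  next
    case 2
    \<comment> \<open>The two landmarks at height \<open>z\<close> leave only mirror images in that
      height; \<open>f2\<close> lies above \<open>z\<close>, so the detour via \<open>f\<close>
      separates them.\<close>
    have "a1 = b1" "\<bar>a2 - z\<bar> = \<bar>b2 - z\<bar>" using 2 eq2 unfolding m3 by linarith+
    then show ?thesis using 2 zb unfolding d1 by (auto simp: abs_if split: if_splits)
  next
    case 3
    \<comment> \<open>A vertex above height \<open>z\<close> gains towards \<open>(n, z)\<close>
      only from the left of \<open>e\<close>, where \<open>d3\<close> depends on the difference of
      the coordinates and \<open>m1\<close> on their sum.\<close>
    have left: "x1 < e1" if "d3 x1 x2 < m3 x1 x2" "z \<le> x2" for x1 x2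
      using that z zb le unfolding d3 m3 by linarith
    consider "z \<le> a2" "z \<le> b2" | "a2 < z" "b2 < z" | "a2 < z" "z \<le> b2" | "z \<le> a2" "b2 < z" by linarith
    then show ?thesis
    proof cases
      case 1
      then have "a1 < e1" "b1 < e1" using left[of a1 a2] left[of b1 b2] 3 by blast+
      then show ?thesis using 1 3 zb unfolding d3 m1 by linarith
    qed (use 3 eq2 in \<open>unfold m1, linarith\<close>)+
  next
    case 4
    \<comment> \<open>No vertex profits from both directions of the edge: one direction requires it
      to be closer to \<open>f\<close> than to \<open>e\<close>, the other the opposite.\<close>
    then show ?thesis using z zb le unfolding d1 m1 d3 m3 by linarith
  qed
qed

text \<open>The pairs that \<open>(1, z)\<close> and \<open>(n, w)\<close> fail to resolve in the plain grid.\<close>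

lemma same_diagonal_or_glide:
  fixes z w dx a1 a2 b1 b2 :: int
  assumes "a1 + \<bar>a2 - z\<bar> = b1 + \<bar>b2 - z\<bar>" "\<bar>a2 - w\<bar> - a1 = \<bar>b2 - w\<bar> - b1" "w \<le> z" "a2 \<le> b2"
  obtains "a1 = b1" "a2 = b2"
  | "w \<le> a2" "a2 < b2" "b2 \<le> z" "b1 - a1 = b2 - a2"
  | "a2 < w" "z < b2" "b1 - a1 = z - w" "a2 + b2 = z + w"
proof -
  have "a1 = b1 \<and> a2 = b2 \<or> w \<le> a2 \<and> a2 < b2 \<and> b2 \<le> z \<and> b1 - a1 = b2 - a2 \<or>
     a2 < w \<and> z < b2 \<and> b1 - a1 = z - w \<and> a2 + b2 = z + w"
    using assms by linarith
  then show thesis using that by blast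
qed

text \<open>The hypotheses on \<open>z\<close> and \<open>w\<close> say that the distances from
  \<open>(1, z)\<close> to the two endpoints differ by exactly 1, and likewise from
  \<open>(n, w)\<close>. The sign is left open because the two constructions below need opposite
  ones.\<close>

lemma landmarks_on_bisector:
  assumes "(e1, e2) \<in> grid_verts n" "(f1, f2) \<in> grid_verts n" "(a1, a2) \<in> grid_verts n"
    and "e1 \<le> f1" "f1 - e1 < f2 - e2" "z = w + f1 - e1" "\<bar>z + w - e2 - f2\<bar> = 1"
  shows "plus_dist (e1, e2) (f1, f2) (a1, a2) (1, z) = a1 - 1 + \<bar>a2 - z\<bar>"
    "plus_dist (e1, e2) (f1, f2) (a1, a2) (int n, w) = int n - a1 + \<bar>a2 - w\<bar>"
    "e2 \<le> w" "z \<le> f2" "(1, z) \<in> grid_verts n" "(int n, w) \<in> grid_verts n" "(1, w) \<in> grid_verts n"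
    "(1, 1) \<in> grid_verts n" "(int n, int n) \<in> grid_verts n"
proof -
  show "e2 \<le> w" "z \<le> f2" using assms by linarith+
  then show "(1, z) \<in> grid_verts n" "(int n, w) \<in> grid_verts n" "(1, w) \<in> grid_verts n"
    "(1, 1) \<in> grid_verts n" "(int n, int n) \<in> grid_verts n"
    using assms by (auto simp: grid_verts_def)
  show "plus_dist (e1, e2) (f1, f2) (a1, a2) (1, z) = a1 - 1 + \<bar>a2 - z\<bar>"
    using assms \<open>e2 \<le> w\<close> \<open>z \<le> f2\<close>
    by (subst plus_dist_no_gain) (auto simp: grid_dist_def grid_verts_def)
  show "plus_dist (e1, e2) (f1, f2) (a1, a2) (int n, w) = int n - a1 + \<bar>a2 - w\<bar>"
    using assms \<open>e2 \<le> w\<close> \<open>z \<le> f2\<close>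
    by (subst plus_dist_no_gain) (auto simp: grid_dist_def grid_verts_def)
qed

text \<open>Inside the strip \<open>(1, w)\<close> is reached best by the direct route, and its
  distance grows along an increasing diagonal. For a glide pair it is nearer to the lower vertex,
  whichever route the upper one takes.\<close>

lemma three_landmarks_even_gain:
  assumes e: "(e1, e2) \<in> grid_verts n" and f: "(f1, f2) \<in> grid_verts n"
    and le: "e1 < f1" "f1 - e1 < f2 - e2" "3 * (f1 - e1) \<le> f2 - e2 + 1"
    and w: "2 * w = e2 + f2 - (f1 - e1) + 1" and z: "z = w + f1 - e1"
  shows "resolves n (e1, e2) (f1, f2) {(1, w), (1, z), (int n, w)}"
proof -
  have "\<bar>z + w - e2 - f2\<bar> = 1" using w z by linarith
  note bis = landmarks_on_bisector[OF e f _ less_imp_le[OF le(1)] le(2) z this]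
  have V: "{(1, w), (1, z), (int n, w)} \<subseteq> grid_verts n" using bis[OF e] by auto
  have range: "e2 \<le> w" "z \<le> f2" "w \<le> z" using bis[OF e] z le by auto
  define m d where m: "m a1 a2 = a1 - 1 + \<bar>a2 - w\<bar>"
    and d: "d a1 a2 = \<bar>a1 - f1\<bar> + \<bar>a2 - f2\<bar> + e1 + w - e2" for a1 a2
  have D: "plus_dist (e1, e2) (f1, f2) (a1, a2) (1, w) = min (m a1 a2) (d a1 a2)"
    if "(a1, a2) \<in> grid_verts n" for a1 a2
    using assms that range by (subst plus_dist_gain) (auto simp: m d grid_dist_def grid_verts_def)
  show ?thesis
  proof (rule resolvesI[OF V])
    fix a1 a2 b1 b2
    assume ab: "a2 \<le> b2" and a: "(a1, a2) \<in> grid_verts n" and b: "(b1, b2) \<in> grid_verts n"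
      and eq: "\<forall>x\<in>{(1, w), (1, z), (int n, w)}. plus_dist (e1, e2) (f1, f2) (a1, a2) x = plus_dist (e1, e2) (f1, f2) (b1, b2) x"
    have bis_eq: "a1 + \<bar>a2 - z\<bar> = b1 + \<bar>b2 - z\<bar>" "\<bar>a2 - w\<bar> - a1 = \<bar>b2 - w\<bar> - b1"
      using eq bis(1,2)[OF a] bis(1,2)[OF b] by auto
    have eq1: "min (m a1 a2) (d a1 a2) = min (m b1 b2) (d b1 b2)"
      using eq D[OF a] D[OF b] by auto
    from bis_eq range(3) ab show "a1 = b1 \<and> a2 = b2"
    proof (cases rule: same_diagonal_or_glide)
      case 2
      \<comment> \<open>The worst case is \<open>x2 = z = w + f1 - e1\<close>, where the inequality
        becomes the hypothesis \<open>3 * (f1 - e1) \<le> f2 - e2 + 1\<close>.\<close>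
      have "m x1 x2 \<le> d x1 x2" if "w \<le> x2" "x2 \<le> z" for x1 x2
      proof -
        have "m x1 x2 = x1 - 1 + x2 - w" "x1 - f1 + f2 - x2 + e1 + w - e2 \<le> d x1 x2"
          using that range by (auto simp: m d)
        then show ?thesis using that le w z by presburger
      qed
      then have "m a1 a2 \<le> d a1 a2" "m b1 b2 \<le> d b1 b2" using 2 by auto
      then have "m a1 a2 = m b1 b2" using eq1 by auto
      then show ?thesis using 2 unfolding m by linarith
    next
      case 3
      have "m a1 a2 < m b1 b2" using 3 range le z unfolding m by linarith
      \<comment> \<open>Strictness comes from rounding \<open>w\<close> up, which gives
        \<open>z + w = e2 + f2 + 1\<close>.\<close>
      moreover have "m a1 a2 < d b1 b2" using 3 range w z unfolding m d by linarith
      ultimately show ?thesis using eq1 by linarith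
    qed auto
  qed
qed

text \<open>On an increasing diagonal the corners could fail only if the upper vertex used the edge
  towards \<open>(1, 1)\<close> and the lower one towards \<open>(n, n)\<close>; the two savings
  together violate the triangle inequality. For glide pairs \<open>(1, 1)\<close> suffices.\<close>

lemma four_landmarks_even_gain:
  assumes e: "(e1, e2) \<in> grid_verts n" and f: "(f1, f2) \<in> grid_verts n"
    and le: "e1 \<le> f1" "f1 - e1 < f2 - e2"
    and w: "2 * w = e2 + f2 - (f1 - e1) - 1" and z: "z = w + f1 - e1"
  shows "resolves n (e1, e2) (f1, f2) {(1, z), (int n, w), (1, 1), (int n, int n)}"
proof -
  have "\<bar>z + w - e2 - f2\<bar> = 1" using w z by linarith
  note bis = landmarks_on_bisector[OF e f _ le(1,2) z this]
  have V: "{(1, z), (int n, w), (1, 1), (int n, int n)} \<subseteq> grid_verts n" using bis[OF e] by auto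
  have range: "e2 \<le> w" "z \<le> f2" "w \<le> z" using bis[OF e] z le by auto
  \<comment> \<open>Edge routes to the corners \<open>(1, 1)\<close> and \<open>(n, n)\<close>,
    shifted by the constants 2 and \<open>- 2 * int n\<close>.\<close>
  define d1 d2 where d1: "d1 a1 a2 = \<bar>a1 - f1\<bar> + \<bar>a2 - f2\<bar> + e1 + e2 + 1"
    and d2: "d2 a1 a2 = \<bar>a1 - e1\<bar> + \<bar>a2 - e2\<bar> + 1 - f1 - f2" for a1 a2
  have D1: "plus_dist (e1, e2) (f1, f2) (a1, a2) (1, 1) = min (a1 + a2) (d1 a1 a2) - 2"
    and D2: "plus_dist (e1, e2) (f1, f2) (a1, a2) (int n, int n) = min (- (a1 + a2)) (d2 a1 a2) + 2 * int n"
    if "(a1, a2) \<in> grid_verts n" for a1 a2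
  proof -
    show "plus_dist (e1, e2) (f1, f2) (a1, a2) (1, 1) = min (a1 + a2) (d1 a1 a2) - 2"
      using assms that
      by (subst plus_dist_gain) (auto simp: d1 grid_dist_def grid_verts_def)
    show "plus_dist (e1, e2) (f1, f2) (a1, a2) (int n, int n) = min (- (a1 + a2)) (d2 a1 a2) + 2 * int n"
      using assms that
      by (subst plus_dist_swap, subst plus_dist_gain) (auto simp: d2 grid_dist_def grid_verts_def)
  qed
  show ?thesis
  proof (rule resolvesI[OF V])
    fix a1 a2 b1 b2
    assume ab: "a2 \<le> b2" and a: "(a1, a2) \<in> grid_verts n" and b: "(b1, b2) \<in> grid_verts n"
      and eq: "\<forall>x\<in>{(1, z), (int n, w), (1, 1), (int n, int n)}.
        plus_dist (e1, e2) (f1, f2) (a1, a2) x = plus_dist (e1, e2) (f1, f2) (b1, b2) x"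
    have bis_eq: "a1 + \<bar>a2 - z\<bar> = b1 + \<bar>b2 - z\<bar>" "\<bar>a2 - w\<bar> - a1 = \<bar>b2 - w\<bar> - b1"
      using eq bis(1,2)[OF a] bis(1,2)[OF b] by auto
    have eq1: "min (a1 + a2) (d1 a1 a2) = min (b1 + b2) (d1 b1 b2)"
      and eq2: "min (- (a1 + a2)) (d2 a1 a2) = min (- (b1 + b2)) (d2 b1 b2)"
      using eq D1[OF a] D1[OF b] D2[OF a] D2[OF b] by auto
    from bis_eq range(3) ab show "a1 = b1 \<and> a2 = b2"
    proof (cases rule: same_diagonal_or_glide)
      case 2
      then have "d1 b1 b2 \<le> a1 + a2" "d2 a1 a2 \<le> - (b1 + b2)"
        using eq1 eq2 by linarith+
      then show ?thesis using 2 unfolding d1 d2 by linarith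
    next
      case 3
      have "a1 + a2 < b1 + b2" using 3 range le by linarith
      \<comment> \<open>Here \<open>w\<close> is rounded down: \<open>z + w = e2 + f2 - 1\<close>
        makes the detour of the upper vertex strictly longer.\<close>
      moreover have "a1 + a2 < d1 b1 b2" using 3 range w z unfolding d1 by linarith
      ultimately show ?thesis using eq1 by linarith
    qed auto
  qed
qed

section \<open>Reduction to the normal position\<close>

definition resolvable :: "nat \<Rightarrow> nat \<Rightarrow> int \<times> int \<Rightarrow> int \<times> int \<Rightarrow> bool" where
  "resolvable k n e f \<longleftrightarrow> (\<exists>R. card R \<le> k \<and> resolves n e f R)"

lemma resolvable_swap: "resolvable k n e f \<longleftrightarrow> resolvable k n f e"
  by (simp add: resolvable_def resolves_def plus_dist_swap)

lemma resolvable_mono: "resolvable k n e f \<Longrightarrow> k \<le> l \<Longrightarrow> resolvable l n e f"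
  unfolding resolvable_def by (meson le_trans)

lemma (in grid_symmetry) resolvable_image:
  assumes "resolvable k n (\<sigma> e) (\<sigma> f)"
  shows "resolvable k n e f"
proof -
  from assms obtain R where "card R \<le> k" "resolves n (\<sigma> e) (\<sigma> f) R"
    by (auto simp: resolvable_def)
  moreover have "inj \<sigma>" by (metis injI invol)
  ultimately show ?thesis
    using resolves_image[of "\<sigma> e" "\<sigma> f" R] unfolding resolvable_def
    by (auto intro!: exI[of _ "\<sigma> ` R"] simp: card_image inj_on_subset)
qed

text \<open>An even sum of the differences means an odd gain; the other disjunct is the inequality
  of \<open>three_landmarks_even_gain\<close> made symmetric in the two directions.\<close>

definition gain_condition :: "int \<Rightarrow> int \<Rightarrow> bool" where
  "gain_condition dx dy \<longleftrightarrow> even (dx + dy) \<or> 3 * min dx dy \<le> max dx dy + 1"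

lemma resolvable_normalised:
  assumes "e \<in> grid_verts n" "f \<in> grid_verts n" "fst e < fst f" "fst f - fst e < snd f - snd e"
  shows "resolvable 4 n e f"
    and "gain_condition (fst f - fst e) (snd f - snd e) \<Longrightarrow> resolvable 3 n e f"
proof -
  obtain e1 e2 f1 f2 where ef: "e = (e1, e2)" "f = (f1, f2)" by (metis surj_pair)
  note a = assms[unfolded ef fst_conv snd_conv]
  \<comment> \<open>The listed landmarks may coincide, so their number is only bounded from
    above.\<close>
  have res3: "resolvable 3 n e f" if "resolves n e f {x, y, z}" for x y z
    using that card_length[of "[x, y, z]"] unfolding resolvable_def
    by (intro exI[of _ "{x, y, z}"]) (simp add: eval_nat_numeral)
  have res4: "resolvable 4 n e f" if "resolves n e f {x, y, z, u}" for x y z u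
    using that card_length[of "[x, y, z, u]"] unfolding resolvable_def
    by (intro exI[of _ "{x, y, z, u}"]) (simp add: eval_nat_numeral)
  have even3: "resolvable 3 n e f" if "even (f1 - e1 + (f2 - e2))"
  proof -
    have "\<exists>z. 2 * z = e2 + f2 + f1 - e1" using that by presburger
    then show ?thesis
      using three_landmarks_odd_gain[OF a(1,2) less_imp_le[OF a(3)] a(4)] res3 unfolding ef by blast
  qed
  have odd: "\<exists>w. 2 * w = e2 + f2 - (f1 - e1) + 1" "\<exists>w. 2 * w = e2 + f2 - (f1 - e1) - 1"
    if "odd (f1 - e1 + (f2 - e2))"
    using that by presburger+
  show "resolvable 4 n e f"
  proof (cases "even (f1 - e1 + (f2 - e2))")
    case True
    then show ?thesis using even3 resolvable_mono[of 3 _ _ _ 4] by simp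
  next
    case False
    then show ?thesis
      using four_landmarks_even_gain[OF a(1,2) less_imp_le[OF a(3)] a(4)] odd res4 unfolding ef by blast
  qed
  assume gc: "gain_condition (fst f - fst e) (snd f - snd e)"
  show "resolvable 3 n e f"
  proof (cases "even (f1 - e1 + (f2 - e2))")
    case False
    then have "3 * min (f1 - e1) (f2 - e2) \<le> max (f1 - e1) (f2 - e2) + 1"
      using gc unfolding gain_condition_def ef fst_conv snd_conv by blast
    then have "3 * (f1 - e1) \<le> f2 - e2 + 1"
      using a by simp
    then show ?thesis
      using three_landmarks_even_gain[OF a] odd False res3 unfolding ef by blast
  qed (rule even3)
qed

text \<open>Reflection puts \<open>e\<close> to the left of \<open>f\<close>, exchanging the
  endpoints puts it below, and transposition makes the vertical difference the larger one.\<close>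

lemma resolvable_if_ne:
  assumes "e \<in> grid_verts n" "f \<in> grid_verts n" "fst e \<noteq> fst f" "snd e \<noteq> snd f"
    and "\<bar>fst e - fst f\<bar> \<noteq> \<bar>snd e - snd f\<bar>"
    and k: "k = 4 \<or> k = 3 \<and> gain_condition \<bar>fst e - fst f\<bar> \<bar>snd e - snd f\<bar>"
  shows "resolvable k n e f"
proof -
  have 1: "resolvable k n e f"
    if "e \<in> grid_verts n" "f \<in> grid_verts n" "fst e < fst f" "\<bar>fst e - fst f\<bar> < snd f - snd e"
      "k = 4 \<or> k = 3 \<and> gain_condition \<bar>fst e - fst f\<bar> \<bar>snd e - snd f\<bar>" for e f
  proof -
    have "\<bar>fst e - fst f\<bar> = fst f - fst e" "\<bar>snd e - snd f\<bar> = snd f - snd e" using that by auto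
    then show ?thesis
      using that resolvable_normalised[of e n f] by auto
  qed
  have 2: "resolvable k n e f"
    if "e \<in> grid_verts n" "f \<in> grid_verts n" "fst e \<noteq> fst f" "\<bar>fst e - fst f\<bar> < snd f - snd e"
      "k = 4 \<or> k = 3 \<and> gain_condition \<bar>fst e - fst f\<bar> \<bar>snd e - snd f\<bar>" for e f
  proof (cases "fst e < fst f")
    case False
    show ?thesis
      by (rule reflect_x.resolvable_image, rule 1)
        (use that False in \<open>auto simp: reflect_x.verts\<close>, auto simp: reflect_x_def abs_minus_commute)
  qed (use 1 that in blast)
  have 3: "resolvable k n e f"
    if "e \<in> grid_verts n" "f \<in> grid_verts n" "fst e \<noteq> fst f" "\<bar>fst e - fst f\<bar> < \<bar>snd f - snd e\<bar>"
      "k = 4 \<or> k = 3 \<and> gain_condition \<bar>fst e - fst f\<bar> \<bar>snd e - snd f\<bar>" for e f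
  proof (cases "snd e \<le> snd f")
    case True
    then show ?thesis using 2 that by auto
  next
    case False
    then have "resolvable k n f e" using that by (intro 2) (auto simp: abs_minus_commute)
    then show ?thesis by (simp add: resolvable_swap)
  qed
  show ?thesis
  proof (cases "\<bar>fst e - fst f\<bar> < \<bar>snd f - snd e\<bar>")
    case True
    then show ?thesis using 3 assms by blast
  next
    case False
    show ?thesis
      by (rule transpose.resolvable_image, rule 3)
        (use assms False in \<open>auto simp: transpose.verts gain_condition_def abs_minus_commute min.commute max.commute add.commute\<close>)
  qed
qed

lemma metric_dim_plus_generic:
  assumes "e \<in> grid_verts n" "f \<in> grid_verts n" "generic n e f"
  shows "metric_dim_plus n (e, f) \<in> {3, 4}"
    and "gain_condition \<bar>fst e - fst f\<bar> \<bar>snd e - snd f\<bar> \<Longrightarrow> metric_dim_plus n (e, f) = 3"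
proof -
  have ge: "3 \<le> metric_dim_plus n (e, f)"
    using assms three_le_card_if_resolves by (intro metric_dim_plus_ge)
  have le: "metric_dim_plus n (e, f) \<le> k" if "resolvable k n e f" for k
    using that metric_dim_plus_le[OF assms(1,2)] le_trans unfolding resolvable_def by blast
  have ne: "fst e \<noteq> fst f" "snd e \<noteq> snd f" "\<bar>fst e - fst f\<bar> \<noteq> \<bar>snd e - snd f\<bar>"
    using assms(3) by (auto simp: generic_def)
  show "metric_dim_plus n (e, f) \<in> {3, 4}"
    using ge le[of 4] resolvable_if_ne[OF assms(1,2) ne, of 4] by auto
  show "metric_dim_plus n (e, f) = 3" if "gain_condition \<bar>fst e - fst f\<bar> \<bar>snd e - snd f\<bar>"
    using ge le[of 3] resolvable_if_ne[OF assms(1,2) ne, of 3] that by auto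
qed

subsection \<open>Counting pairs of endpoints\<close>

text \<open>Four separate integer coordinates allow reordering the sums and estimating the innermost
  one alone.\<close>

definition quad_sum :: "nat \<Rightarrow> (int \<Rightarrow> int \<Rightarrow> int \<Rightarrow> int \<Rightarrow> real) \<Rightarrow> real" where
  "quad_sum n F = (\<Sum>e1\<in>{1..int n}. \<Sum>e2\<in>{1..int n}. \<Sum>f1\<in>{1..int n}. \<Sum>f2\<in>{1..int n}. F e1 e2 f1 f2)"

definition freq :: "nat \<Rightarrow> (int \<Rightarrow> int \<Rightarrow> int \<Rightarrow> int \<Rightarrow> bool) \<Rightarrow> real" where
  "freq n P = quad_sum n (\<lambda>e1 e2 f1 f2. of_bool (P e1 e2 f1 f2)) / real n ^ 4"

lemma quad_sum_add: "quad_sum n (\<lambda>e1 e2 f1 f2. F e1 e2 f1 f2 + G e1 e2 f1 f2) = quad_sum n F + quad_sum n G"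
  by (simp add: quad_sum_def sum.distrib)

lemma quad_sum_scale: "quad_sum n (\<lambda>e1 e2 f1 f2. c * F e1 e2 f1 f2) = c * quad_sum n F"
  by (simp add: quad_sum_def sum_distrib_left)

lemma quad_sum_mono:
  assumes "\<And>e1 e2 f1 f2. {e1, e2, f1, f2} \<subseteq> {1..int n} \<Longrightarrow> F e1 e2 f1 f2 \<le> G e1 e2 f1 f2"
  shows "quad_sum n F \<le> quad_sum n G"
  unfolding quad_sum_def using assms by (intro sum_mono) auto

lemma quad_sum_cong:
  assumes "\<And>e1 e2 f1 f2. {e1, e2, f1, f2} \<subseteq> {1..int n} \<Longrightarrow> F e1 e2 f1 f2 = G e1 e2 f1 f2"
  shows "quad_sum n F = quad_sum n G"
  using assms by (intro antisym quad_sum_mono) auto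

lemma quad_sum_const: "quad_sum n (\<lambda>_ _ _ _. c) = c * real n ^ 4"
  by (simp add: quad_sum_def power4_eq_xxxx)

lemma quad_sum_swap_ef: "quad_sum n F = quad_sum n (\<lambda>e1 e2 f1 f2. F f1 f2 e1 e2)"
proof -
  let ?I = "{1..int n}"
  have "quad_sum n F = (\<Sum>e1\<in>?I. \<Sum>f1\<in>?I. \<Sum>e2\<in>?I. \<Sum>f2\<in>?I. F e1 e2 f1 f2)"
    unfolding quad_sum_def by (intro sum.cong refl sum.swap)
  also have "\<dots> = (\<Sum>f1\<in>?I. \<Sum>e1\<in>?I. \<Sum>f2\<in>?I. \<Sum>e2\<in>?I. F e1 e2 f1 f2)"
    by (subst sum.swap, intro sum.cong refl sum.swap)
  also have "\<dots> = quad_sum n (\<lambda>e1 e2 f1 f2. F f1 f2 e1 e2)"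
    unfolding quad_sum_def by (intro sum.cong refl sum.swap)
  finally show ?thesis .
qed

lemma quad_sum_swap_xy: "quad_sum n F = quad_sum n (\<lambda>e1 e2 f1 f2. F e2 e1 f2 f1)"
proof -
  let ?I = "{1..int n}"
  have "quad_sum n F = (\<Sum>e2\<in>?I. \<Sum>e1\<in>?I. \<Sum>f2\<in>?I. \<Sum>f1\<in>?I. F e1 e2 f1 f2)"
    unfolding quad_sum_def by (subst sum.swap, intro sum.cong refl sum.swap)
  then show ?thesis by (simp add: quad_sum_def)
qed

lemma quad_sum_fibre_le:
  assumes "\<And>e1 e2 f1. {e1, e2, f1} \<subseteq> {1..int n} \<Longrightarrow> \<bar>\<Sum>f2\<in>{1..int n}. F e1 e2 f1 f2\<bar> \<le> K"
  shows "\<bar>quad_sum n F\<bar> \<le> K * real n ^ 3"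
proof -
  have "\<bar>quad_sum n F\<bar> \<le> (\<Sum>e1\<in>{1..int n}. \<Sum>e2\<in>{1..int n}. \<Sum>f1\<in>{1..int n}. \<bar>\<Sum>f2\<in>{1..int n}. F e1 e2 f1 f2\<bar>)"
    unfolding quad_sum_def by (intro order_trans[OF sum_abs] sum_mono order_refl)
  also have "\<dots> \<le> (\<Sum>e1\<in>{1..int n}. \<Sum>e2\<in>{1..int n}. \<Sum>f1\<in>{1..int n}. K)"
    using assms by (intro sum_mono) auto
  finally show ?thesis by (simp add: power3_eq_cube ac_simps)
qed

lemma freq_nonneg: "0 \<le> freq n P"
  unfolding freq_def quad_sum_def by (intro divide_nonneg_nonneg sum_nonneg) auto

lemma freq_True: "0 < n \<Longrightarrow> freq n (\<lambda>_ _ _ _. True) = 1"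
  by (simp add: freq_def quad_sum_const)

lemma freq_diff_le:
  assumes "\<And>e1 e2 f1 f2. {e1, e2, f1, f2} \<subseteq> {1..int n} \<Longrightarrow> \<not> B e1 e2 f1 f2 \<Longrightarrow>
      P e1 e2 f1 f2 \<longleftrightarrow> Q e1 e2 f1 f2"
  shows "\<bar>freq n P - freq n Q\<bar> \<le> freq n B"
proof -
  let ?c = "\<lambda>P. quad_sum n (\<lambda>e1 e2 f1 f2. of_bool (P e1 e2 f1 f2))"
  have "?c P \<le> quad_sum n (\<lambda>e1 e2 f1 f2. of_bool (Q e1 e2 f1 f2) + of_bool (B e1 e2 f1 f2))"
    "?c Q \<le> quad_sum n (\<lambda>e1 e2 f1 f2. of_bool (P e1 e2 f1 f2) + of_bool (B e1 e2 f1 f2))"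
    using assms by (intro quad_sum_mono; force)+
  then have "\<bar>?c P - ?c Q\<bar> \<le> ?c B"
    unfolding quad_sum_add by linarith
  then show ?thesis
    unfolding freq_def diff_divide_distrib[symmetric] abs_divide by (simp add: divide_right_mono)
qed

text \<open>Two independent uniform vertices form a uniform pair, so probabilities are normalised
  counts over four coordinates.\<close>

lemma measure_endpoints_pmf:
  assumes "0 < n"
  shows "\<P>(w in endpoints_pmf n. P w) = freq n (\<lambda>e1 e2 f1 f2. P ((e1, e2), (f1, f2)))"
proof -
  let ?V = "grid_verts n" and ?I = "{1..int n}"
  have ne: "?V \<noteq> {}" "?V \<times> ?V \<noteq> {}" and fin: "finite ?V" "finite (?V \<times> ?V)"
    using assms by (auto simp: grid_verts_def)
  have "endpoints_pmf n = pmf_of_set (?V \<times> ?V)"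
  proof (rule pmf_eqI)
    fix w
    show "pmf (endpoints_pmf n) w = pmf (pmf_of_set (?V \<times> ?V)) w"
      using ne fin by (cases w)
        (auto simp: endpoints_pmf_def pmf_pair pmf_of_set card_cartesian_product indicator_def)
  qed
  then have "\<P>(w in endpoints_pmf n. P w) = real (card (?V \<times> ?V \<inter> {w. P w})) / real (card (?V \<times> ?V))"
    using measure_pmf_of_set[OF ne(2) fin(2)] by simp
  also have "real (card (?V \<times> ?V)) = real n ^ 4"
    by (simp add: grid_verts_def card_cartesian_product power4_eq_xxxx)
  also have "real (card (?V \<times> ?V \<inter> {w. P w})) = (\<Sum>w\<in>?V \<times> ?V. of_bool (P w))"
    using fin(2) by (simp add: sum.If_cases of_bool_def)
  also have "\<dots> = quad_sum n (\<lambda>e1 e2 f1 f2. of_bool (P ((e1, e2), (f1, f2))))"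
    unfolding quad_sum_def grid_verts_def sum.cartesian_product' ..
  finally show ?thesis by (simp add: freq_def)
qed

section \<open>Negligible sets of endpoints\<close>

definition negligible :: "(nat \<Rightarrow> int \<Rightarrow> int \<Rightarrow> int \<Rightarrow> int \<Rightarrow> bool) \<Rightarrow> bool" where
  "negligible P \<longleftrightarrow> (\<lambda>n. freq n (P n)) \<longlonglongrightarrow> 0"

lemma negligible_mono:
  assumes "negligible Q" "\<And>n e1 e2 f1 f2. {e1, e2, f1, f2} \<subseteq> {1..int n} \<Longrightarrow> P n e1 e2 f1 f2 \<Longrightarrow> Q n e1 e2 f1 f2"
  shows "negligible P"
  unfolding negligible_def
proof (rule tendsto_sandwich[OF _ _ tendsto_const assms(1)[unfolded negligible_def]])
  show "\<forall>\<^sub>F n in sequentially. freq n (P n) \<le> freq n (Q n)"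
    unfolding freq_def using assms(2)
    by (intro always_eventually allI divide_right_mono quad_sum_mono) auto
qed (simp add: freq_nonneg)

lemma negligible_disj:
  assumes "negligible P" "negligible Q"
  shows "negligible (\<lambda>n e1 e2 f1 f2. P n e1 e2 f1 f2 \<or> Q n e1 e2 f1 f2)"
  unfolding negligible_def
proof (rule tendsto_sandwich[OF _ _ tendsto_const])
  show "\<forall>\<^sub>F n in sequentially. freq n (\<lambda>e1 e2 f1 f2. P n e1 e2 f1 f2 \<or> Q n e1 e2 f1 f2) \<le> freq n (P n) + freq n (Q n)"
    unfolding freq_def add_divide_distrib[symmetric] quad_sum_add[symmetric]
    by (intro always_eventually allI divide_right_mono quad_sum_mono) auto
  show "(\<lambda>n. freq n (P n) + freq n (Q n)) \<longlonglongrightarrow> 0"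
    using tendsto_add[OF assms[unfolded negligible_def]] by simp
qed (simp add: freq_nonneg)

lemma negligible_swap_ef: "negligible (\<lambda>n e1 e2 f1 f2. P n f1 f2 e1 e2) \<Longrightarrow> negligible P"
  unfolding negligible_def freq_def by (subst quad_sum_swap_ef)

lemma negligible_swap_xy: "negligible (\<lambda>n e1 e2 f1 f2. P n e2 e1 f2 f1) \<Longrightarrow> negligible P"
  unfolding negligible_def freq_def by (subst quad_sum_swap_xy)

text \<open>With at most \<open>K\<close> values of \<open>f2\<close> for each of the
  \<open>n^3\<close> choices of the other coordinates, the frequency is at most
  \<open>K / n\<close>.\<close>

lemma negligible_fibre:
  assumes "\<And>n e1 e2 f1 f2. P n e1 e2 f1 f2 \<Longrightarrow> f2 \<in> set (S n e1 e2 f1)"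
    and "\<And>n e1 e2 f1. length (S n e1 e2 f1) \<le> K"
  shows "negligible P"
  unfolding negligible_def
proof (rule tendsto_sandwich[OF _ _ tendsto_const])
  have "\<bar>quad_sum n (\<lambda>e1 e2 f1 f2. of_bool (P n e1 e2 f1 f2))\<bar> \<le> real K * real n ^ 3" for n
  proof (rule quad_sum_fibre_le)
    fix e1 e2 f1
    have "(\<Sum>f2\<in>{1..int n}. of_bool (P n e1 e2 f1 f2)) = real (card {f2 \<in> {1..int n}. P n e1 e2 f1 f2})"
      by (simp add: sum.If_cases of_bool_def Int_def)
    also have "card {f2 \<in> {1..int n}. P n e1 e2 f1 f2} \<le> card (set (S n e1 e2 f1))"
      using assms(1) by (intro card_mono) auto
    also have "\<dots> \<le> K" using card_length assms(2) le_trans by blast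
    finally show "\<bar>\<Sum>f2\<in>{1..int n}. of_bool (P n e1 e2 f1 f2)\<bar> \<le> real K" by simp
  qed
  then have "freq n (P n) \<le> real K * real n ^ 3 / real n ^ 4" for n
    unfolding freq_def by (rule divide_right_mono[OF abs_le_D1]) auto
  moreover have "real K * real n ^ 3 / real n ^ 4 = real K / real n" if "0 < n" for n
    using that by (simp add: field_simps power4_eq_xxxx power3_eq_cube)
  ultimately have "freq n (P n) \<le> real K / real n" if "0 < n" for n
    using that by metis
  then show "\<forall>\<^sub>F n in sequentially. freq n (P n) \<le> real K / real n"
    by (rule eventually_mono[OF eventually_gt_at_top[of 0]])
  show "(\<lambda>n. real K / real n) \<longlonglongrightarrow> 0"
    by (rule lim_const_over_n)
qed (simp add: freq_nonneg)

text \<open>Besides the negation of \<open>generic\<close>, neighbourhoods of the lines where one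
  difference is three times the other are excluded; there additive constants in
  \<open>event_C\<close> could matter.\<close>

definition exceptional :: "nat \<Rightarrow> int \<Rightarrow> int \<Rightarrow> int \<Rightarrow> int \<Rightarrow> bool" where
  "exceptional n e1 e2 f1 f2 \<longleftrightarrow> \<not> {e1, e2, f1, f2} \<subseteq> {3..int n - 2} \<or> e1 = f1 \<or> e2 = f2 \<or>
     \<bar>\<bar>e1 - f1\<bar> - \<bar>e2 - f2\<bar>\<bar> \<le> 6 \<or> \<bar>3 * \<bar>e1 - f1\<bar> - \<bar>e2 - f2\<bar>\<bar> \<le> 6 \<or> \<bar>3 * \<bar>e2 - f2\<bar> - \<bar>e1 - f1\<bar>\<bar> \<le> 6"

lemma negligible_exceptional: "negligible exceptional"
proof -
  have near_line: "negligible (\<lambda>n e1 e2 f1 f2. \<bar>c * \<bar>e1 - f1\<bar> - \<bar>e2 - f2\<bar>\<bar> \<le> 6)" for c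
  \<comment> \<open>Two windows of 13 integers each, one for either sign of
    \<open>f2 - e2\<close>.\<close>
  proof (rule negligible_fibre[where K = 26])
    fix e1 e2 f1 f2 :: int
    define r where "r = c * \<bar>e1 - f1\<bar>"
    assume "\<bar>c * \<bar>e1 - f1\<bar> - \<bar>e2 - f2\<bar>\<bar> \<le> 6"
    then have "f2 - (e2 + r) \<in> {-6..6} \<or> f2 - (e2 - r) \<in> {-6..6}"
      unfolding r_def[symmetric] by auto
    then show "f2 \<in> set ([e2 + r - 6..e2 + r + 6] @ [e2 - r - 6..e2 - r + 6])"
      by auto
  qed simp
  have edge: "negligible (\<lambda>n e1 e2 f1 f2. f2 \<in> {1..int n} \<and> f2 \<notin> {3..int n - 2})"
    by (rule negligible_fibre[of _ "\<lambda>n _ _ _. [1, 2, int n - 1, int n]" 4]) auto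
  have eq: "negligible (\<lambda>n e1 e2 f1 f2. e2 = f2)"
    by (rule negligible_fibre[of _ "\<lambda>n e1 e2 f1. [e2]" 1]) auto
  have edge': "negligible (\<lambda>n e1 e2 f1 f2. f1 \<in> {1..int n} \<and> f1 \<notin> {3..int n - 2})"
    by (rule negligible_swap_xy, rule edge)
  note disj = negligible_disj[OF edge negligible_disj[OF edge' negligible_disj[OF
    negligible_swap_ef[of "\<lambda>n e1 e2 f1 f2. e2 \<in> {1..int n} \<and> e2 \<notin> {3..int n - 2}", OF edge]
    negligible_disj[OF negligible_swap_ef[of "\<lambda>n e1 e2 f1 f2. e1 \<in> {1..int n} \<and> e1 \<notin> {3..int n - 2}", OF edge']
    negligible_disj[OF eq negligible_disj[OF negligible_swap_xy[of "\<lambda>n e1 e2 f1 f2. e1 = f1", OF eq]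
    negligible_disj[OF near_line[of 1, unfolded mult_1] negligible_disj[OF near_line[of 3]
    negligible_swap_xy[of "\<lambda>n e1 e2 f1 f2. \<bar>3 * \<bar>e2 - f2\<bar> - \<bar>e1 - f1\<bar>\<bar> \<le> 6", OF near_line[of 3]]]]]]]]]]
  show ?thesis
    by (rule negligible_mono[OF disj]) (unfold exceptional_def insert_subset, blast)
qed

section \<open>Cancellation of parities\<close>

definition alt :: "int \<Rightarrow> real" where
  "alt k = (if even k then 1 else -1)"

lemma alt_add: "alt (a + b) = alt a * alt b"
  by (auto simp: alt_def)

lemma abs_alt [simp]: "\<bar>alt k\<bar> = 1"
  by (auto simp: alt_def)

text \<open>Neighbouring signs cancel in pairs, leaving at most one term.\<close>

lemma sum_alt_interval: "\<bar>\<Sum>k\<in>{a..b}. alt k\<bar> \<le> 1"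
proof -
  have "(\<Sum>k\<in>{a..a + int m - 1}. alt k) = (if even m then 0 else alt a)" for m
  proof (induction m)
    case (Suc m)
    have "{a..a + int (Suc m) - 1} = insert (a + int m) {a..a + int m - 1}" by auto
    then show ?case using Suc by (auto simp: alt_def)
  qed simp
  from this[of "nat (b + 1 - a)"] show ?thesis
    by (cases "a \<le> b") (auto simp: alt_def)
qed

lemma sum_alt_ball: "\<bar>\<Sum>k\<in>{1..int n}. alt k * of_bool (\<bar>c - k\<bar> \<le> r)\<bar> \<le> 1"
proof -
  have "(\<Sum>k\<in>{1..int n}. alt k * of_bool (\<bar>c - k\<bar> \<le> r)) = (\<Sum>k\<in>{max 1 (c - r)..min (int n) (c + r)}. alt k)"
    by (intro sum.mono_neutral_cong_right) auto
  then show ?thesis using sum_alt_interval by metis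
qed

text \<open>The second condition of \<open>event_C\<close> without its additive constants: the
  larger difference exceeds three times the smaller.\<close>

definition slanted :: "int \<Rightarrow> int \<Rightarrow> int \<Rightarrow> int \<Rightarrow> bool" where
  "slanted e1 e2 f1 f2 \<longleftrightarrow> 3 * \<bar>e1 - f1\<bar> < \<bar>e2 - f2\<bar> \<or> 3 * \<bar>e2 - f2\<bar> < \<bar>e1 - f1\<bar>"

text \<open>The complement of \<open>slanted\<close> is a difference of two intervals in the variable \<open>f2\<close>, on each of which
  the signs cancel; so even and odd \<open>e1 + e2 + f1 + f2\<close> are equally frequent there.\<close>

lemma alternating_count_le:
  "\<bar>quad_sum n (\<lambda>e1 e2 f1 f2. alt (e1 + e2 + f1 + f2) * of_bool (\<not> slanted e1 e2 f1 f2))\<bar> \<le> 2 * real n ^ 3"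
proof (rule quad_sum_fibre_le)
  fix e1 e2 f1 :: int
  define r where "r = \<bar>e1 - f1\<bar>"
  \<comment> \<open>\<open>(r - 1) div 3\<close> is the largest \<open>x\<close> with
    \<open>3 * x < r\<close>. For \<open>r = 0\<close> it is -1 and the subtracted ball is
    empty.\<close>
  have split: "(of_bool (\<not> slanted e1 e2 f1 f2) :: real) = of_bool (\<bar>e2 - f2\<bar> \<le> 3 * r) - of_bool (\<bar>e2 - f2\<bar> \<le> (r - 1) div 3)" for f2
  proof -
    have "x \<le> (r - 1) div 3 \<longleftrightarrow> 3 * x < r" for x by presburger
    moreover have "0 \<le> r" by (simp add: r_def)
    ultimately show ?thesis unfolding slanted_def r_def[symmetric] by (auto simp: of_bool_def)
  qed
  have "(\<Sum>f2\<in>{1..int n}. alt (e1 + e2 + f1 + f2) * of_bool (\<not> slanted e1 e2 f1 f2)) =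
    alt (e1 + e2 + f1) * ((\<Sum>f2\<in>{1..int n}. alt f2 * of_bool (\<bar>e2 - f2\<bar> \<le> 3 * r)) -
      (\<Sum>f2\<in>{1..int n}. alt f2 * of_bool (\<bar>e2 - f2\<bar> \<le> (r - 1) div 3)))"
    unfolding split alt_add[of "e1 + e2 + f1"] right_diff_distrib sum_subtractf sum_distrib_left mult.assoc ..
  then have "\<bar>\<Sum>f2\<in>{1..int n}. alt (e1 + e2 + f1 + f2) * of_bool (\<not> slanted e1 e2 f1 f2)\<bar> =
    \<bar>(\<Sum>f2\<in>{1..int n}. alt f2 * of_bool (\<bar>e2 - f2\<bar> \<le> 3 * r)) -
      (\<Sum>f2\<in>{1..int n}. alt f2 * of_bool (\<bar>e2 - f2\<bar> \<le> (r - 1) div 3))\<bar>"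
    by (simp add: abs_mult)
  also have "\<dots> \<le> 2"
    using sum_alt_ball[of e2 "3 * r" n] sum_alt_ball[of e2 "(r - 1) div 3" n] by linarith
  finally show "\<bar>\<Sum>f2\<in>{1..int n}. alt (e1 + e2 + f1 + f2) * of_bool (\<not> slanted e1 e2 f1 f2)\<bar> \<le> 2" .
qed

section \<open>Counting by coordinate differences\<close>

lemma sum_differences:
  fixes g :: "int \<Rightarrow> real"
  shows "(\<Sum>x\<in>{1..int n}. \<Sum>y\<in>{1..int n}. g \<bar>x - y\<bar>) = real n * g 0 + 2 * (\<Sum>d\<in>{1..<n}. (real n - real d) * g (int d))"
proof (induction n)
  case (Suc n)
  have I: "{1..int (Suc n)} = insert (int (Suc n)) {1..int n}" by auto
  \<comment> \<open>The induction step adds a new row and a new column; each contains every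
    difference from 1 to \<open>n\<close> once.\<close>
  have "bij_betw (\<lambda>d. int (Suc n) - int d) {1..<Suc n} {1..int n}"
    by (rule bij_betw_byWitness[of _ "\<lambda>x. nat (int (Suc n) - x)"]) auto
  then have row: "(\<Sum>y\<in>{1..int n}. g \<bar>int (Suc n) - y\<bar>) = (\<Sum>d\<in>{1..<Suc n}. g (int d))"
    by (subst sum.reindex_bij_betw[symmetric]) (auto intro!: sum.cong)
  have "(\<Sum>x\<in>{1..int (Suc n)}. \<Sum>y\<in>{1..int (Suc n)}. g \<bar>x - y\<bar>) =
      g 0 + (\<Sum>y\<in>{1..int n}. g \<bar>int (Suc n) - y\<bar>) + (\<Sum>x\<in>{1..int n}. g \<bar>x - int (Suc n)\<bar>) +
      (\<Sum>x\<in>{1..int n}. \<Sum>y\<in>{1..int n}. g \<bar>x - y\<bar>)"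
    unfolding I by (simp add: sum.distrib)
  also have "(\<Sum>x\<in>{1..int n}. g \<bar>x - int (Suc n)\<bar>) = (\<Sum>y\<in>{1..int n}. g \<bar>int (Suc n) - y\<bar>)"
    by (simp only: abs_minus_commute)
  finally show ?case
    unfolding Suc row by (simp add: sum.distrib[symmetric] sum_distrib_left algebra_simps)
qed simp

text \<open>A difference \<open>d > 0\<close> belongs to \<open>2 * (n - d)\<close> ordered pairs;
  summing over \<open>d > k\<close> gives twice a triangular number.\<close>

lemma count_large_differences:
  assumes "0 \<le> k"
  shows "(\<Sum>x\<in>{1..int n}. \<Sum>y\<in>{1..int n}. of_bool (k < \<bar>x - y\<bar>)) =
    (if k \<le> int n then (real n - k) * (real n - k - 1) else (0::real))"
proof -
  have "2 * (\<Sum>d\<in>{1..<n}. (real n - real d) * of_bool (k < int d)) =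
    (if k \<le> int n then (real n - k) * (real n - k - 1) else (0::real))"
  proof (induction n)
    case (Suc n)
    have "(\<Sum>d\<in>{1..<Suc n}. of_bool (k < int d)) = (if k \<le> int n then real n - k else 0)"
      using assms by (induction n) (auto simp: not_le)
    moreover have "(\<Sum>d\<in>{1..<Suc n}. (real (Suc n) - real d) * of_bool (k < int d)) =
      (\<Sum>d\<in>{1..<Suc n}. (real n - real d) * of_bool (k < int d) + of_bool (k < int d))"
      by (intro sum.cong refl) (simp add: of_bool_def)
    moreover have "(\<Sum>d\<in>{1..<Suc n}. (real n - real d) * of_bool (k < int d)) =
      (\<Sum>d\<in>{1..<n}. (real n - real d) * of_bool (k < int d))"
      by (cases n) auto
    ultimately have "2 * (\<Sum>d\<in>{1..<Suc n}. (real (Suc n) - real d) * of_bool (k < int d)) =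
        (if k \<le> int n then (real n - k) * (real n - k - 1) + 2 * (real n - k) else 0)"
      using Suc by (simp add: sum.distrib)
    also have "\<dots> = (if k \<le> int (Suc n) then (real (Suc n) - k) * (real (Suc n) - k - 1) else 0)"
      \<comment> \<open>At \<open>k = n + 1\<close> the product on the right also vanishes.\<close>
      by (cases "k = int (Suc n)") (auto simp: algebra_simps)
    finally show ?case .
  qed (use assms in auto)
  then show ?thesis
    unfolding sum_differences[of "\<lambda>d. of_bool (k < d)"] using assms by (simp only: not_less[symmetric]) simp
qed

text \<open>Expansion in powers of \<open>d\<close>; the factor 12 clears the denominators 2, 6 and
  4 of the power sums.\<close>

lemma sum_cubic:
  "12 * (\<Sum>d\<in>{1..k}. (x - real d) * (x - 3 * real d) * (x - 3 * real d - 1)) =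
    12 * (x ^ 3 - x ^ 2) * real k + 6 * (4 * x - 7 * x ^ 2) * (real k * (real k + 1))
    + 2 * (15 * x - 3) * (real k * (real k + 1) * (2 * real k + 1)) - 27 * (real k ^ 2 * (real k + 1) ^ 2)"
  by (induction k) (simp_all add: algebra_simps power2_eq_square power3_eq_cube)

text \<open>For a fixed horizontal difference \<open>d\<close> the vertical pairs are counted first;
  they exist only for \<open>3 * d \<le> n\<close>, hence the bound \<open>n div 3\<close>. The term
  \<open>d = 0\<close> stands apart.\<close>

lemma count_steep:
  "quad_sum n (\<lambda>e1 e2 f1 f2. of_bool (3 * \<bar>e1 - f1\<bar> < \<bar>e2 - f2\<bar>)) =
    real n ^ 2 * (real n - 1) +
    2 * (\<Sum>d\<in>{1..n div 3}. (real n - real d) * (real n - 3 * real d) * (real n - 3 * real d - 1))"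
proof -
  let ?I = "{1..int n}"
  define h where "h d = (if 3 * d \<le> int n then (real n - 3 * d) * (real n - 3 * d - 1) else (0::real))" for d :: int
  have "quad_sum n (\<lambda>e1 e2 f1 f2. of_bool (3 * \<bar>e1 - f1\<bar> < \<bar>e2 - f2\<bar>)) =
      (\<Sum>e1\<in>?I. \<Sum>f1\<in>?I. \<Sum>e2\<in>?I. \<Sum>f2\<in>?I. of_bool (3 * \<bar>e1 - f1\<bar> < \<bar>e2 - f2\<bar>))"
    unfolding quad_sum_def by (intro sum.cong refl sum.swap)
  also have "\<dots> = (\<Sum>e1\<in>?I. \<Sum>f1\<in>?I. h \<bar>e1 - f1\<bar>)"
    by (intro sum.cong refl) (subst count_large_differences, auto simp: h_def)
  also have "\<dots> = real n * h 0 + 2 * (\<Sum>d\<in>{1..<n}. (real n - real d) * h (int d))"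
    by (rule sum_differences)
  also have "(\<Sum>d\<in>{1..<n}. (real n - real d) * h (int d)) =
      (\<Sum>d\<in>{1..n div 3}. (real n - real d) * (real n - 3 * real d) * (real n - 3 * real d - 1))"
    by (rule sum.mono_neutral_cong_right) (auto simp: h_def)
  also have "real n * h 0 = real n ^ 2 * (real n - 1)"
    by (simp add: h_def power2_eq_square)
  finally show ?thesis .
qed

text \<open>The value is twice the integral of \<open>(1 - x) * (1 - 3 * x)^2\<close> from 0 to 1/3,
  obtained here from the exact count.\<close>

lemma freq_steep_tendsto:
  "(\<lambda>n. freq n (\<lambda>e1 e2 f1 f2. 3 * \<bar>e1 - f1\<bar> < \<bar>e2 - f2\<bar>)) \<longlonglongrightarrow> 11 / 54"
proof -
  define t u where "t n = real (n div 3) / real n" and "u n = 1 / real n" for n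
  have u: "u \<longlonglongrightarrow> 0" unfolding u_def by (rule lim_const_over_n)
  have t: "t \<longlonglongrightarrow> 1 / 3"
  proof (rule tendsto_sandwich)
    have "1 / 3 - u n \<le> t n \<and> t n \<le> 1 / 3" if "0 < n" for n
    proof -
      have "real n \<le> 3 * real (n div 3) + 3" "3 * real (n div 3) \<le> real n" by linarith+
      then show ?thesis
        using that divide_right_mono[of "real n" "3 * real (n div 3) + 3" "3 * real n"]
        by (simp add: t_def u_def divide_le_eq add_divide_distrib algebra_simps)
    qed
    then show "\<forall>\<^sub>F n in sequentially. 1 / 3 - u n \<le> t n" "\<forall>\<^sub>F n in sequentially. t n \<le> 1 / 3"
      by (auto intro: eventually_mono[OF eventually_gt_at_top[of 0]])
    show "(\<lambda>n. 1 / 3 - u n) \<longlonglongrightarrow> 1 / 3" using tendsto_diff[OF tendsto_const u] by simp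
  qed simp
  txt \<open>\<open>p\<close> is the right-hand side of \<open>sum_cubic\<close> homogenised with \<open>x = (n div 3) / n\<close> and \<open>y = 1 / n\<close>.\<close>
  define p where "p x y = 6 * y * (1 - y) + 12 * (1 - y) * x + 6 * (4 * y - 7) * (x * (x + y))
    + 2 * (15 - 3 * y) * (x * (x + y) * (2 * x + y)) - 27 * (x ^ 2 * (x + y) ^ 2)" for x y :: real
  have "(\<lambda>n. p (t n) (u n) / 6) \<longlonglongrightarrow> p (1 / 3) 0 / 6"
    unfolding p_def by (intro tendsto_intros t u) auto
  also have "p (1 / 3) 0 / 6 = 11 / 54" by (simp add: p_def power2_eq_square)
  finally have "(\<lambda>n. p (t n) (u n) / 6) \<longlonglongrightarrow> 11 / 54" .
  moreover have "\<forall>\<^sub>F n in sequentially. p (t n) (u n) / 6 = freq n (\<lambda>e1 e2 f1 f2. 3 * \<bar>e1 - f1\<bar> < \<bar>e2 - f2\<bar>)"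
  proof (rule eventually_mono[OF eventually_gt_at_top])
    fix n :: nat assume pos: "0 < n"
    have "real (n div 3) = real n * t n" "real n * u n = 1"
      using pos by (simp_all add: t_def u_def)
    \<comment> \<open>Multiplying by 6 turns the factor 2 of \<open>count_steep\<close> into the 12
      of \<open>sum_cubic\<close>.\<close>
    then have "6 * quad_sum n (\<lambda>e1 e2 f1 f2. of_bool (3 * \<bar>e1 - f1\<bar> < \<bar>e2 - f2\<bar>)) = real n ^ 4 * p (t n) (u n)"
      using count_steep[of n] sum_cubic[of "real n" "n div 3"] unfolding p_def by algebra
    then show "p (t n) (u n) / 6 = freq n (\<lambda>e1 e2 f1 f2. 3 * \<bar>e1 - f1\<bar> < \<bar>e2 - f2\<bar>)"
      using pos by (simp add: freq_def field_simps)
  qed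
  ultimately show ?thesis by (rule Lim_transform_eventually)
qed

text \<open>The limit is \<open>1/2 + 11/54\<close>: half of all pairs, half of the slanted ones,
  and an alternating remainder that vanishes.\<close>

lemma freq_even_or_slanted_tendsto:
  "(\<lambda>n. freq n (\<lambda>e1 e2 f1 f2. even (e1 + e2 + f1 + f2) \<or> slanted e1 e2 f1 f2)) \<longlonglongrightarrow> 19 / 27"
proof -
  define T where "T n = freq n (\<lambda>e1 e2 f1 f2. 3 * \<bar>e1 - f1\<bar> < \<bar>e2 - f2\<bar>)" for n
  define A where "A n = quad_sum n (\<lambda>e1 e2 f1 f2. alt (e1 + e2 + f1 + f2) * of_bool (\<not> slanted e1 e2 f1 f2)) / real n ^ 4" for n
  have A: "A \<longlonglongrightarrow> 0"
  proof (rule Lim_null_comparison)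
    show "\<forall>\<^sub>F n in sequentially. norm (A n) \<le> 2 / real n"
      using eventually_gt_at_top[of 0]
    proof eventually_elim
      case (elim n)
      have "norm (A n) \<le> 2 * real n ^ 3 / real n ^ 4"
        unfolding A_def real_norm_def abs_divide using alternating_count_le[of n]
        by (simp add: divide_right_mono)
      also have "\<dots> = 2 / real n" using elim by (simp add: power4_eq_xxxx power3_eq_cube)
      finally show ?case .
    qed
    show "(\<lambda>n. 2 / real n) \<longlonglongrightarrow> 0" by (rule lim_const_over_n)
  qed
  have disjoint: False if "3 * \<bar>e2 - f2\<bar> < \<bar>e1 - f1\<bar>" "3 * \<bar>e1 - f1\<bar> < \<bar>e2 - f2\<bar>" for e1 e2 f1 f2 :: int
    using that by presburger
  have "freq n (\<lambda>e1 e2 f1 f2. even (e1 + e2 + f1 + f2) \<or> slanted e1 e2 f1 f2) = 1 / 2 + T n + A n / 2"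
    if "0 < n" for n
  proof -
    let ?S = "\<lambda>e1 e2 f1 f2. of_bool (3 * \<bar>e1 - f1\<bar> < \<bar>e2 - f2\<bar>) :: real"
    let ?A = "\<lambda>e1 e2 f1 f2. alt (e1 + e2 + f1 + f2) * of_bool (\<not> slanted e1 e2 f1 f2)"
    \<comment> \<open>The indicator is 1 on slanted pairs and \<open>(1 + alt) / 2\<close> on the
      others; the slanted pairs split into two disjoint transposed copies.\<close>
    have "quad_sum n (\<lambda>e1 e2 f1 f2. of_bool (even (e1 + e2 + f1 + f2) \<or> slanted e1 e2 f1 f2)) =
      quad_sum n (\<lambda>e1 e2 f1 f2. 1 / 2 + (1 / 2 * ?S e1 e2 f1 f2 + (1 / 2 * ?S e2 e1 f2 f1 + 1 / 2 * ?A e1 e2 f1 f2)))"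
      by (intro quad_sum_cong) (auto simp: alt_def slanted_def of_bool_def dest: disjoint)
    also have "\<dots> = 1 / 2 * real n ^ 4 + (1 / 2 * quad_sum n ?S +
        (1 / 2 * quad_sum n (\<lambda>e1 e2 f1 f2. ?S e2 e1 f2 f1) + 1 / 2 * quad_sum n ?A))"
      by (simp only: quad_sum_add quad_sum_scale quad_sum_const)
    also have "quad_sum n (\<lambda>e1 e2 f1 f2. ?S e2 e1 f2 f1) = quad_sum n ?S"
      by (rule quad_sum_swap_xy[symmetric])
    finally show ?thesis
      using that unfolding freq_def T_def A_def by (simp add: field_simps)
  qed
  then have "\<forall>\<^sub>F n in sequentially. 1 / 2 + T n + A n / 2 =
      freq n (\<lambda>e1 e2 f1 f2. even (e1 + e2 + f1 + f2) \<or> slanted e1 e2 f1 f2)"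
    by (intro eventually_mono[OF eventually_gt_at_top[of 0]]) simp
  moreover have "(\<lambda>n. 1 / 2 + T n + A n / 2) \<longlonglongrightarrow> 1 / 2 + 11 / 54 + 0 / 2"
    unfolding T_def by (intro tendsto_intros A freq_steep_tendsto) auto
  ultimately show ?thesis using Lim_transform_eventually by fastforce
qed

lemma freq_tendsto_if_eq_outside_negligible:
  assumes "negligible B" "(\<lambda>n. freq n (Q n)) \<longlonglongrightarrow> L"
    and "\<And>n e1 e2 f1 f2. {e1, e2, f1, f2} \<subseteq> {1..int n} \<Longrightarrow> \<not> B n e1 e2 f1 f2 \<Longrightarrow>
      P n e1 e2 f1 f2 \<longleftrightarrow> Q n e1 e2 f1 f2"
  shows "(\<lambda>n. freq n (P n)) \<longlonglongrightarrow> L"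
proof -
  have "(\<lambda>n. freq n (P n) - freq n (Q n)) \<longlonglongrightarrow> 0"
  proof (rule Lim_null_comparison)
    show "\<forall>\<^sub>F n in sequentially. norm (freq n (P n) - freq n (Q n)) \<le> freq n (B n)"
      using assms(3) unfolding real_norm_def by (intro always_eventually allI freq_diff_le)
  qed (use assms(1) in \<open>simp add: negligible_def\<close>)
  from tendsto_add[OF this assms(2)] show ?thesis by simp
qed

subsection \<open>The limits\<close>

text \<open>Away from the excluded lines the maximum in \<open>gain'\<close> is not 0, and
  \<open>3 * a\<close> differs from \<open>b\<close> by more than 6 (likewise with \<open>a\<close>
  and \<open>b\<close> exchanged), so the small constants in the inequalities change
  nothing.\<close>

lemma event_C_iff:
  assumes "\<not> exceptional n e1 e2 f1 f2"
  shows "event_C ((e1, e2), (f1, f2)) \<longleftrightarrow> even (e1 + e2 + f1 + f2) \<or> slanted e1 e2 f1 f2"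
    and "event_C ((e1, e2), (f1, f2)) \<longleftrightarrow> gain_condition \<bar>e1 - f1\<bar> \<bar>e2 - f2\<bar>"
proof -
  define a b where ab: "a = \<bar>e1 - f1\<bar>" "b = \<bar>e2 - f2\<bar>"
  have far: "6 < \<bar>a - b\<bar>" "6 < \<bar>3 * a - b\<bar>" "6 < \<bar>3 * b - a\<bar>" "0 \<le> a" "0 \<le> b"
    using assms unfolding exceptional_def ab by auto
  have gain: "gain' ((e1, e2), (f1, f2)) = \<bar>b - a\<bar> - 1"
    using far unfolding gain'_def ab by (simp add: abs_minus_commute)
  have "even (\<bar>b - a\<bar>) \<longleftrightarrow> even (e1 + e2 + f1 + f2)" "even (a + b) \<longleftrightarrow> even (e1 + e2 + f1 + f2)"
    by (auto simp: ab)
  moreover have "real_of_int (min a b) < real_of_int (\<bar>b - a\<bar> - 1) / 2 + 2 \<longleftrightarrow> 2 * min a b < \<bar>b - a\<bar> + 3"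
  proof -
    have "real_of_int x < real_of_int y / 2 + 2 \<longleftrightarrow> 2 * x < y + 4" for x y by linarith
    from this[of "min a b" "\<bar>b - a\<bar> - 1"] show ?thesis by (simp only:) linarith
  qed
  moreover have "(2 * min a b < \<bar>b - a\<bar> + 3 \<longleftrightarrow> 3 * a < b \<or> 3 * b < a) \<and>
    (3 * min a b \<le> max a b + 1 \<longleftrightarrow> 3 * a < b \<or> 3 * b < a)"
  proof (cases "a \<le> b")
    case True
    then have "min a b = a" "max a b = b" "\<bar>b - a\<bar> = b - a" "\<not> 3 * b < a" "3 * a < b - 6 \<or> b + 6 < 3 * a"
      using far by auto
    then show ?thesis by auto
  next
    case False
    then have "min a b = b" "max a b = a" "\<bar>b - a\<bar> = a - b" "\<not> 3 * a < b" "3 * b < a - 6 \<or> a + 6 < 3 * b"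
      using far by auto
    then show ?thesis by auto
  qed
  ultimately show "event_C ((e1, e2), (f1, f2)) \<longleftrightarrow> even (e1 + e2 + f1 + f2) \<or> slanted e1 e2 f1 f2"
    and "event_C ((e1, e2), (f1, f2)) \<longleftrightarrow> gain_condition \<bar>e1 - f1\<bar> \<bar>e2 - f2\<bar>"
    unfolding event_C_def slanted_def gain_condition_def case_prod_conv gain ab[symmetric] by auto
qed

lemma metric_dim_plus_not_exceptional:
  assumes "{e1, e2, f1, f2} \<subseteq> {1..int n}" "\<not> exceptional n e1 e2 f1 f2"
  shows "metric_dim_plus n ((e1, e2), (f1, f2)) \<in> {3, 4}"
    and "event_C ((e1, e2), (f1, f2)) \<Longrightarrow> metric_dim_plus n ((e1, e2), (f1, f2)) = 3"
proof -
  have "generic n (e1, e2) (f1, f2)"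
    using assms(2) by (auto simp: exceptional_def generic_def)
  moreover have "(e1, e2) \<in> grid_verts n" "(f1, f2) \<in> grid_verts n"
    using assms(1) by (auto simp: grid_verts_def)
  ultimately show "metric_dim_plus n ((e1, e2), (f1, f2)) \<in> {3, 4}"
    and "event_C ((e1, e2), (f1, f2)) \<Longrightarrow> metric_dim_plus n ((e1, e2), (f1, f2)) = 3"
    using metric_dim_plus_generic[of "(e1, e2)" n "(f1, f2)"] event_C_iff(2)[OF assms(2)] by simp_all
qed

theorem theorem3:
  shows "((\<lambda>n. \<P>(w in endpoints_pmf n. metric_dim_plus n w \<in> {3, 4})) \<longlonglongrightarrow> 1)
    \<and> ((\<lambda>n. \<P>(w in endpoints_pmf n. metric_dim_plus n w = 3 \<bar> event_C w)) \<longlonglongrightarrow> 1)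
    \<and> ((\<lambda>n. \<P>(w in endpoints_pmf n. event_C w)) \<longlonglongrightarrow> 19 / 27)"
proof -
  \<comment> \<open>Limits of probabilities reduce to limits of frequencies outside the exceptional
    set; only \<open>n > 0\<close> is considered, where the grid is nonempty.\<close>
  have prob_tendsto: "(\<lambda>n. \<P>(w in endpoints_pmf n. P n w)) \<longlonglongrightarrow> L"
    if "(\<lambda>n. freq n (Q n)) \<longlonglongrightarrow> L"
      "\<And>n e1 e2 f1 f2. {e1, e2, f1, f2} \<subseteq> {1..int n} \<Longrightarrow> \<not> exceptional n e1 e2 f1 f2 \<Longrightarrow>
        P n ((e1, e2), (f1, f2)) \<longleftrightarrow> Q n e1 e2 f1 f2" for P Q L
  proof (rule Lim_transform_eventually)
    show "(\<lambda>n. freq n (\<lambda>e1 e2 f1 f2. P n ((e1, e2), (f1, f2)))) \<longlonglongrightarrow> L"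
      by (rule freq_tendsto_if_eq_outside_negligible[OF negligible_exceptional that(1)]) (rule that(2))
    show "\<forall>\<^sub>F n in sequentially. freq n (\<lambda>e1 e2 f1 f2. P n ((e1, e2), (f1, f2))) = \<P>(w in endpoints_pmf n. P n w)"
      by (intro eventually_mono[OF eventually_gt_at_top[of 0]]) (rule measure_endpoints_pmf[symmetric])
  qed
  have "(\<lambda>n. freq n (\<lambda>_ _ _ _. True)) \<longlonglongrightarrow> 1"
    by (intro tendsto_eventually eventually_mono[OF eventually_gt_at_top[of 0]]) (simp only: freq_True)
  then have dim: "(\<lambda>n. \<P>(w in endpoints_pmf n. metric_dim_plus n w \<in> {3, 4})) \<longlonglongrightarrow> 1"
    by (rule prob_tendsto) (simp only: simp_thms metric_dim_plus_not_exceptional(1))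
  have C: "(\<lambda>n. \<P>(w in endpoints_pmf n. event_C w)) \<longlonglongrightarrow> 19 / 27"
    using freq_even_or_slanted_tendsto by (rule prob_tendsto) (rule event_C_iff(1))
  have "(\<lambda>n. \<P>(w in endpoints_pmf n. metric_dim_plus n w = 3 \<and> event_C w)) \<longlonglongrightarrow> 19 / 27"
    using freq_even_or_slanted_tendsto
  proof (rule prob_tendsto)
    fix n e1 e2 f1 f2
    assume "{e1, e2, f1, f2} \<subseteq> {1..int n}" "\<not> exceptional n e1 e2 f1 f2"
    from event_C_iff(1)[OF this(2)] metric_dim_plus_not_exceptional(2)[OF this]
    show "metric_dim_plus n ((e1, e2), f1, f2) = 3 \<and> event_C ((e1, e2), f1, f2) \<longleftrightarrow>
        even (e1 + e2 + f1 + f2) \<or> slanted e1 e2 f1 f2" by blast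
  qed
  \<comment> \<open>Outside the exceptional set \<open>event_C\<close> forces dimension 3, so the
    joint event has the same limit; as 19/27 is not 0, the quotient tends to 1.\<close>
  from tendsto_divide[OF this C] have "(\<lambda>n. \<P>(w in endpoints_pmf n. metric_dim_plus n w = 3 \<bar> event_C w)) \<longlonglongrightarrow> 1"
    unfolding cond_prob_def by simp
  with dim C show ?thesis by blast
qed

end
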